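(* Let $\mu$ be a probability measure on $\mathbb{R}^d$. Suppose $f\in C(\mathbb{R}^d)\cap L^1(\mathbb{R}^d)$ and its Fourier transform $\widehat f\in L^1(\mathbb{R}^d)$. For every integer $n\ge1$ there exist trainable parameters $\theta=\{\boldsymbol{a},\boldsymbol{b},\Gamma,\boldsymbol{c},c_0\}$, with $n$ qubits, of the quantum neural network (QNN) defined in the context, such that the QNN output $u_\theta(\boldsymbol{x})$ satisfies $$\|f-u_\theta\|_{L^2(\mu)}\le\frac{\|\widehat f\|_{L^1}}{\sqrt n}.$$
   Context: Conventions. $C(\mathbb{R}^d)$ is the space of continuous real-valued functions on $\mathbb{R}^d$; $\widehat f(\xi)=\int_{\mathbb{R}^d}f(x)e^{-i\,\xi\cdot x}\,\mathrm{d}x$; $\|\widehat f\|_{L^1}=\int_{\mathbb{R}^d}|\widehat f(\xi)|\,\mathrm{d}\xi$; $\|\cdot\|_{L^2(\mu)}$ is the $L^2$ norm with respect to $\mu$. QNN architecture. The input dimension $d$ and the number of variational layers $L$ are given positive integers, and $n$ is the number of qubits. The state space is $(\mathbb{C}^2)^{\otimes n}$ with standard basis state $|0\rangle^{\otimes n}$. The parameters are $\boldsymbol{a}=(\boldsymbol{a}_1,\dots,\boldsymbol{a}_n)\in(\mathbb{R}^d)^n$, $\boldsymbol{b}=(b_1,\dots,b_n)\in\mathbb{R}^n$, $\Gamma=\{(\alpha_{\ell i},\beta_{\ell i},\gamma_{\ell i})\in\mathbb{R}^3:1\le \ell\le L,\ 1\le i\le n\}$, $\boldsymbol{c}=(c_1,\dots,c_n)\in\mathbb{R}^n$,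 $c_0\in\mathbb{R}$. Single-qubit gates: $$R_y(z)=\begin{pmatrix}\cos(z/2)&-\sin(z/2)\\ \sin(z/2)&\cos(z/2)\end{pmatrix},\qquad R_z(\alpha)=\begin{pmatrix}e^{-i\alpha/2}&0\\0&e^{i\alpha/2}\end{pmatrix}.$$ Feature map: for $\boldsymbol{x}\in\mathbb{R}^d$ put $z_i=\boldsymbol{a}_i^T\boldsymbol{x}+b_i$ and $U_{\psi(\boldsymbol{x})}=\bigotimes_{i=1}^n R_y(z_i)$. Entangling operation, a chain of CNOT gates arranged in a circular pattern: $E=\big(\prod_{k=1}^{n-1}\mathrm{CNOT}_{k,k+1}\big)\mathrm{CNOT}_{n,1}$, where $\mathrm{CNOT}_{j,k}$ has control qubit $j$ and target qubit $k$ (no separate convention is specified for $n=1$). Variational layers: $U(\Gamma^\ell)=E\big(\bigotimes_{i=1}^n R_z(\gamma_{\ell i})R_y(\beta_{\ell i})R_z(\alpha_{\ell i})\big)$, where $\Gamma^\ell=\{(\alpha_{\ell i},\beta_{\ell i},\gamma_{\ell i}):i=1,\dots,n\}$, and $U_\Theta(\Gamma)=\prod_{\ell=1}^L U(\Gamma^\ell)$ (layers composed in order). Measurement: with $Z=\mathrm{diag}(1,-1)$ and $Z_i=I^{\otimes(i-1)}\otimes Z\otimes I^{\otimes(n-i)}$, the $i$-th quantum expectation is $$\phi_i(\boldsymbol{x})=\langle 0|^{\otimes n}\big(U_\Theta(\Gamma)U_{\psi(\boldsymbol{x})}\big)^\dagger Z_i\,\big(U_\Theta(\Gamma)U_{\psi(\boldsymbol{x})}\big)|0\rangle^{\otimes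 n}.$$ Output: $u_\theta(\boldsymbol{x})=\sum_{i=1}^n c_i\phi_i(\boldsymbol{x})+c_0$. *)

theory Defs
  imports
    "HOL-Probability.Probability_Measure"
    "Jordan_Normal_Form.Schur_Decomposition"
begin

definition fourier :: "(real ^ 'd \<Rightarrow> real) \<Rightarrow> real ^ 'd \<Rightarrow> complex" where
  "fourier f \<xi> = (LINT x|lborel. complex_of_real (f x) * exp (- (\<i> * complex_of_real (inner \<xi> x))))"

(* The Bochner integral of a non-integrable function is 0, so these two norms only have their
   usual meaning together with an explicit integrability statement. *)
definition l1_norm :: "(real ^ 'd \<Rightarrow> complex) \<Rightarrow> real" where
  "l1_norm g = (LINT \<xi>|lborel. norm (g \<xi>))"

definition l2_norm :: "'a measure \<Rightarrow> ('a \<Rightarrow> complex) \<Rightarrow> real" where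
  "l2_norm M g = sqrt (LINT x|M. (norm (g x))\<^sup>2)"

definition kron :: "complex mat \<Rightarrow> complex mat \<Rightarrow> complex mat" where
  "kron A B = mat (dim_row A * dim_row B) (dim_col A * dim_col B)
     (\<lambda>(r, s). A $$ (r div dim_row B, s div dim_col B) * B $$ (r mod dim_row B, s mod dim_col B))"

(* Qubits are numbered 1, ..., n from left to right, so qubit 1 is the most significant bit of a
   basis index. *)
definition tensor :: "nat \<Rightarrow> (nat \<Rightarrow> complex mat) \<Rightarrow> complex mat" where
  "tensor n A = foldr kron (map A [1..<Suc n]) (1\<^sub>m 1)"

(* Product F 1 * F 2 * ... * F m, written in the order of the factors as matrices:
   F m acts first on a state. *)
definition ordered_prod :: "nat \<Rightarrow> nat \<Rightarrow> (nat \<Rightarrow> complex mat) \<Rightarrow> complex mat" where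
  "ordered_prod N m F = foldr (*) (map F [1..<Suc m]) (1\<^sub>m N)"

definition Ry :: "real \<Rightarrow> complex mat" where
  "Ry z = mat_of_rows_list 2
     [[complex_of_real (cos (z / 2)), - complex_of_real (sin (z / 2))],
      [complex_of_real (sin (z / 2)), complex_of_real (cos (z / 2))]]"

definition Rz :: "real \<Rightarrow> complex mat" where
  "Rz \<alpha> = mat_of_rows_list 2
     [[exp (- (\<i> * complex_of_real \<alpha> / 2)), 0],
      [0, exp (\<i> * complex_of_real \<alpha> / 2)]]"

definition pauli_X :: "complex mat" where
  "pauli_X = mat_of_rows_list 2 [[0, 1], [1, 0]]"

definition pauli_Z :: "complex mat" where
  "pauli_Z = mat_of_rows_list 2 [[1, 0], [0, - 1]]"

definition proj0 :: "complex mat" where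
  "proj0 = mat_of_rows_list 2 [[1, 0], [0, 0]]"

definition proj1 :: "complex mat" where
  "proj1 = mat_of_rows_list 2 [[0, 0], [0, 1]]"

(* Control j, target k, for distinct j and k: |0><0| on qubit j and the identity elsewhere,
   plus |1><1| on qubit j, X on qubit k and the identity elsewhere. *)
definition cnot :: "nat \<Rightarrow> nat \<Rightarrow> nat \<Rightarrow> complex mat" where
  "cnot n j k =
     tensor n (\<lambda>i. if i = j then proj0 else 1\<^sub>m 2) +
     tensor n (\<lambda>i. if i = j then proj1 else if i = k then pauli_X else 1\<^sub>m 2)"

(* A single qubit admits no CNOT gate, so there the entangling operation is the identity. *)
definition entangler :: "nat \<Rightarrow> complex mat" where
  "entangler n =
     (if n = 1 then 1\<^sub>m (2 ^ n)
      else ordered_prod (2 ^ n) (n - 1) (\<lambda>k. cnot n k (k + 1)) * cnot n n 1)"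

definition feature_map ::
  "nat \<Rightarrow> (nat \<Rightarrow> real ^ 'd) \<Rightarrow> (nat \<Rightarrow> real) \<Rightarrow> real ^ 'd \<Rightarrow> complex mat" where
  "feature_map n a b x = tensor n (\<lambda>i. Ry (inner (a i) x + b i))"

definition layer :: "nat \<Rightarrow> (nat \<Rightarrow> real \<times> real \<times> real) \<Rightarrow> complex mat" where
  "layer n G = entangler n *
     tensor n (\<lambda>i. case G i of (\<alpha>, \<beta>, \<gamma>) \<Rightarrow> Rz \<gamma> * Ry \<beta> * Rz \<alpha>)"

definition variational :: "nat \<Rightarrow> nat \<Rightarrow> (nat \<Rightarrow> nat \<Rightarrow> real \<times> real \<times> real) \<Rightarrow> complex mat" where
  "variational n L \<Gamma> = ordered_prod (2 ^ n) L (\<lambda>l. layer n (\<Gamma> l))"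

definition Z_on :: "nat \<Rightarrow> nat \<Rightarrow> complex mat" where
  "Z_on n i = tensor n (\<lambda>k. if k = i then pauli_Z else 1\<^sub>m 2)"

definition ket0 :: "nat \<Rightarrow> complex vec" where
  "ket0 n = unit_vec (2 ^ n) 0"

(* v \<bullet>c w conjugates w, so the bra is the right-hand argument. The expectation is kept as a
   complex number instead of taking a real part; it is real because Z_on n i is Hermitian. *)
definition expectation_Z ::
  "nat \<Rightarrow> nat \<Rightarrow> (nat \<Rightarrow> real ^ 'd) \<Rightarrow> (nat \<Rightarrow> real) \<Rightarrow> (nat \<Rightarrow> nat \<Rightarrow> real \<times> real \<times> real) \<Rightarrow>
   nat \<Rightarrow> real ^ 'd \<Rightarrow> complex" where
  "expectation_Z n L a b \<Gamma> i x =
     (let U = variational n L \<Gamma> * feature_map n a b x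
      in ((mat_adjoint U * Z_on n i * U) *\<^sub>v ket0 n) \<bullet>c ket0 n)"

(* Only the parameters with index i in {1..n} and layer index l in {1..L} are ever used. *)
definition qnn_output ::
  "nat \<Rightarrow> nat \<Rightarrow> (nat \<Rightarrow> real ^ 'd) \<Rightarrow> (nat \<Rightarrow> real) \<Rightarrow> (nat \<Rightarrow> nat \<Rightarrow> real \<times> real \<times> real) \<Rightarrow>
   (nat \<Rightarrow> real) \<Rightarrow> real \<Rightarrow> real ^ 'd \<Rightarrow> complex" where
  "qnn_output n L a b \<Gamma> c c0 x =
     (\<Sum>i = 1..n. complex_of_real (c i) * expectation_Z n L a b \<Gamma> i x) + complex_of_real c0"

end

theory Submission
  imports
    Defs
    "HOL-Probability.Characteristic_Functions"
    "HOL-Real_Asymp.Real_Asymp"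
begin

text \<open>
  By Fourier inversion,
  \<open>f x = (2 * pi) powr (- d) * (integral of fourier f \<xi> * exp (\<i> * inner \<xi> x) over \<xi>)\<close>.
  Drawing the frequency \<open>\<xi>\<close> with density proportional to the modulus of the transform exhibits f as the
  mean of random cosines \<open>C * cos (inner \<xi> x + \<beta>)\<close> with \<open>C = l1_norm (fourier f) / (2 * pi) ^ d\<close>. An average of
  m suitable ones approximates f in \<open>L\<^sup>2(\<mu>)\<close> up to \<open>C / sqrt m\<close>, because the errors of independent
  samples are orthogonal on average (lemmas \<open>fourier_inversion\<close>, \<open>maurey_sampling\<close>, \<open>cosine_approximation\<close>).

  The circuit has to produce many such cosines independently, in spite of the entangling operations and
  for every depth L. This is studied in the Heisenberg picture, where the measured observable travels
  backwards through the gates. Usually an entangling operation spreads a Pauli observable over further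
  qubits. But for neighbouring qubits j and k = j + 1 with j at least 2, it turns X on j and Y on k
  into Y on j and Z on k, and single-qubit rotations turn this back into X on j and Y on k. So, with suitable
  angles, the measurement of k remains confined to the pair (j, k) in every layer, and ends as X on j and
  Z on k. In the product state prepared by the feature map its expectation is \<open>sin z\<^sub>j * cos z\<^sub>k\<close>. With
  \<open>z\<^sub>j = pi / 2\<close> this is a cosine with freely chosen frequency and phase
  (lemmas \<open>variational_intertwine\<close>, \<open>expectation_Z_eq\<close>, \<open>qnn_realizes_cosine_sum\<close>).

  The pairs (2, 3), (4, 5), ... yield \<open>m = (n - 1) div 2\<close> cosines, fewer than the n that the rate \<open>1 / sqrt n\<close>
  seems to require. The factor \<open>(2 * pi) ^ d\<close> in the inversion formula makes up for this:
  \<open>C\<^sup>2 \<le> (l1_norm (fourier f))\<^sup>2 / 36\<close>, and \<open>n \<le> 36 * m\<close> as soon as there is one pair. For \<open>n \<le> 2\<close> the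
  zero network suffices, since \<open>\<bar>f x\<bar> \<le> C\<close>.
\<close>

section \<open>Adjoints of complex matrices\<close>

lemma mat_adjoint_carrier:
  fixes A :: "complex mat"
  assumes "A \<in> carrier_mat m n"
  shows "mat_adjoint A \<in> carrier_mat n m"
  using assms unfolding mat_adjoint_def by auto

lemma mat_adjoint_index:
  fixes A :: "complex mat"
  assumes "A \<in> carrier_mat m n" "i < n" "j < m"
  shows "mat_adjoint A $$ (i, j) = cnj (A $$ (j, i))"
  using assms unfolding mat_adjoint_def
  by (simp add: mat_of_rows_def conjugate_vec_def col_def)

lemma mat_adjoint_mult:
  fixes A B :: "complex mat"
  assumes A: "A \<in> carrier_mat m n" and B: "B \<in> carrier_mat n k"
  shows "mat_adjoint (A * B) = mat_adjoint B * mat_adjoint A"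
proof (rule eq_matI)
  note car = mat_adjoint_carrier[OF A] mat_adjoint_carrier[OF B]
    mat_adjoint_carrier[OF mult_carrier_mat[OF A B]]
  show "dim_row (mat_adjoint (A * B)) = dim_row (mat_adjoint B * mat_adjoint A)"
    "dim_col (mat_adjoint (A * B)) = dim_col (mat_adjoint B * mat_adjoint A)"
    using car by auto
  fix i j assume "i < dim_row (mat_adjoint B * mat_adjoint A)" "j < dim_col (mat_adjoint B * mat_adjoint A)"
  then have ij: "i < k" "j < m" using car by auto
  have "mat_adjoint (A * B) $$ (i, j) = cnj ((A * B) $$ (j, i))"
    using mat_adjoint_index[OF mult_carrier_mat[OF A B] ij] .
  also have "\<dots> = (\<Sum>l = 0..<n. cnj (A $$ (j, l)) * cnj (B $$ (l, i)))"
    using A B ij by (simp add: scalar_prod_def)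
  also have "\<dots> = (\<Sum>l = 0..<n. mat_adjoint B $$ (i, l) * mat_adjoint A $$ (l, j))"
    using ij by (intro sum.cong) (auto simp: mat_adjoint_index[OF A] mat_adjoint_index[OF B])
  also have "\<dots> = (mat_adjoint B * mat_adjoint A) $$ (i, j)"
    using car ij by (simp add: scalar_prod_def)
  finally show "mat_adjoint (A * B) $$ (i, j) = (mat_adjoint B * mat_adjoint A) $$ (i, j)" .
qed

lemma mat_adjoint_add:
  fixes A B :: "complex mat"
  assumes A: "A \<in> carrier_mat m n" and B: "B \<in> carrier_mat m n"
  shows "mat_adjoint (A + B) = mat_adjoint A + mat_adjoint B"
proof (rule eq_matI)
  note car = mat_adjoint_carrier[OF A] mat_adjoint_carrier[OF B]
    mat_adjoint_carrier[OF add_carrier_mat[OF B, of A]]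
  show "dim_row (mat_adjoint (A + B)) = dim_row (mat_adjoint A + mat_adjoint B)"
    "dim_col (mat_adjoint (A + B)) = dim_col (mat_adjoint A + mat_adjoint B)"
    using car by auto
  fix i j assume "i < dim_row (mat_adjoint A + mat_adjoint B)" "j < dim_col (mat_adjoint A + mat_adjoint B)"
  then have "i < n" "j < m" using car by auto
  then show "mat_adjoint (A + B) $$ (i, j) = (mat_adjoint A + mat_adjoint B) $$ (i, j)"
    using A B car by (simp add: mat_adjoint_index[OF A] mat_adjoint_index[OF B] mat_adjoint_index[OF add_carrier_mat[OF B, of A]])
qed

section \<open>Two-by-two matrices\<close>

abbreviation m22 :: "complex \<Rightarrow> complex \<Rightarrow> complex \<Rightarrow> complex \<Rightarrow> complex mat" where
  "m22 a b c d \<equiv> mat_of_rows_list 2 [[a, b], [c, d]]"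

lemma m22_carrier [simp]: "m22 a b c d \<in> carrier_mat 2 2"
  by (intro carrier_matI) (simp_all add: mat_of_rows_list_def)

lemma m22_index [simp]:
  "m22 a b c d $$ (0, 0) = a" "m22 a b c d $$ (0, Suc 0) = b"
  "m22 a b c d $$ (Suc 0, 0) = c" "m22 a b c d $$ (Suc 0, Suc 0) = d"
  by (simp_all add: mat_of_rows_list_def)

lemma less_two: "(i :: nat) < 2 \<longleftrightarrow> i = 0 \<or> i = Suc 0"
  by auto

lemma eq_mat_22I:
  assumes "A \<in> carrier_mat 2 2" "B \<in> carrier_mat 2 2"
    and "A $$ (0, 0) = B $$ (0, 0)" "A $$ (0, Suc 0) = B $$ (0, Suc 0)"
    and "A $$ (Suc 0, 0) = B $$ (Suc 0, 0)" "A $$ (Suc 0, Suc 0) = B $$ (Suc 0, Suc 0)"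
  shows "A = B"
  using assms by (intro eq_matI) (auto simp: less_two)

lemma m22_mult [simp]:
  "m22 a b c d * m22 a' b' c' d' =
     m22 (a * a' + b * c') (a * b' + b * d') (c * a' + d * c') (c * b' + d * d')"
  by (rule eq_mat_22I[OF mult_carrier_mat[OF m22_carrier m22_carrier] m22_carrier])
     (simp_all add: mat_of_rows_list_def scalar_prod_def)

lemma m22_add [simp]:
  "m22 a b c d + m22 a' b' c' d' = m22 (a + a') (b + b') (c + c') (d + d')"
  by (rule eq_mat_22I[OF add_carrier_mat[OF m22_carrier] m22_carrier])
     (simp_all add: mat_of_rows_list_def)

lemma m22_smult [simp]: "k \<cdot>\<^sub>m m22 a b c d = m22 (k * a) (k * b) (k * c) (k * d)"
  by (rule eq_mat_22I[OF smult_carrier_mat[OF m22_carrier] m22_carrier])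
     (simp_all add: mat_of_rows_list_def)

lemma m22_one: "1\<^sub>m 2 = m22 1 0 0 1"
  by (rule eq_mat_22I[OF one_carrier_mat m22_carrier]) simp_all

lemma m22_adjoint [simp]: "mat_adjoint (m22 a b c d) = m22 (cnj a) (cnj c) (cnj b) (cnj d)"
  by (rule eq_mat_22I[OF mat_adjoint_carrier[OF m22_carrier] m22_carrier])
     (simp_all add: mat_adjoint_index[OF m22_carrier])

lemma m22_cong:
  "a = a' \<Longrightarrow> b = b' \<Longrightarrow> c = c' \<Longrightarrow> d = d' \<Longrightarrow> m22 a b c d = m22 a' b' c' d'"
  by simp

section \<open>Kronecker products\<close>

lemma kron_carrier [simp]:
  assumes "A \<in> carrier_mat a b" "B \<in> carrier_mat c d"
  shows "kron A B \<in> carrier_mat (a * c) (b * d)"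
  using assms by (auto simp: kron_def)

lemma kron_index:
  assumes "A \<in> carrier_mat a b" "B \<in> carrier_mat c d" "i < a * c" "j < b * d"
  shows "kron A B $$ (i, j) = A $$ (i div c, j div d) * B $$ (i mod c, j mod d)"
  using assms by (simp add: kron_def)

lemma sum_lessThan_mult:
  fixes f :: "nat \<Rightarrow> 'a :: comm_monoid_add"
  shows "(\<Sum>l = 0..<m * k. f l) = (\<Sum>p = 0..<m. \<Sum>q = 0..<k. f (p * k + q))"
proof -
  have "(\<Sum>l = 0..<m * k. f l) = (\<Sum>p<m. sum f {p * k..<p * k + k})"
    unfolding atLeast0LessThan by (rule sum.nat_group[symmetric])
  also have "\<dots> = (\<Sum>p<m. \<Sum>q<k. f (p * k + q))"
  proof (rule sum.cong[OF refl])
    fix p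
    show "sum f {p * k..<p * k + k} = (\<Sum>q<k. f (p * k + q))"
      using sum.shift_bounds_nat_ivl[of f 0 "p * k" k] by (simp add: atLeast0LessThan add.commute)
  qed
  finally show ?thesis unfolding atLeast0LessThan .
qed

text \<open>The mixed-product rule. The column index of the left factor runs through pairs of column indices,
  so the defining sum of the matrix product splits into a product of two sums.\<close>

lemma kron_mult:
  assumes A: "A \<in> carrier_mat a b" and B: "B \<in> carrier_mat c d"
    and C: "C \<in> carrier_mat b e" and D: "D \<in> carrier_mat d g"
  shows "kron A B * kron C D = kron (A * C) (B * D)"
proof (rule eq_matI)
  note car = kron_carrier[OF A B] kron_carrier[OF C D]
    kron_carrier[OF mult_carrier_mat[OF A C] mult_carrier_mat[OF B D]]
  show "dim_row (kron A B * kron C D) = dim_row (kron (A * C) (B * D))"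
    "dim_col (kron A B * kron C D) = dim_col (kron (A * C) (B * D))"
    using car by auto
  fix i j assume "i < dim_row (kron (A * C) (B * D))" "j < dim_col (kron (A * C) (B * D))"
  then have i: "i < a * c" and j: "j < e * g" using car by auto
  have i': "i div c < a" "i mod c < c" and j': "j div g < e" "j mod g < g"
    using i j by (auto simp: less_mult_imp_div_less intro!: mod_less_divisor intro: gr0I)
  have "(kron A B * kron C D) $$ (i, j) = (\<Sum>l = 0..<b * d. kron A B $$ (i, l) * kron C D $$ (l, j))"
    using car i j by (simp add: scalar_prod_def)
  also have "\<dots> = (\<Sum>l = 0..<b * d. A $$ (i div c, l div d) * B $$ (i mod c, l mod d)
      * (C $$ (l div d, j div g) * D $$ (l mod d, j mod g)))"
    using i j by (intro sum.cong) (auto simp: kron_index[OF A B] kron_index[OF C D])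
  also have "\<dots> = (\<Sum>p = 0..<b. \<Sum>q = 0..<d. A $$ (i div c, p) * B $$ (i mod c, q)
      * (C $$ (p, j div g) * D $$ (q, j mod g)))"
    by (subst sum_lessThan_mult) (auto intro!: sum.cong)
  also have "\<dots> = (\<Sum>p = 0..<b. A $$ (i div c, p) * C $$ (p, j div g)) *
      (\<Sum>q = 0..<d. B $$ (i mod c, q) * D $$ (q, j mod g))"
    by (simp add: sum_product mult_ac)
  also have "\<dots> = (A * C) $$ (i div c, j div g) * (B * D) $$ (i mod c, j mod g)"
    using A B C D i' j' by (simp add: scalar_prod_def)
  also have "\<dots> = kron (A * C) (B * D) $$ (i, j)"
    using kron_index[OF mult_carrier_mat[OF A C] mult_carrier_mat[OF B D] i j] by simp
  finally show "(kron A B * kron C D) $$ (i, j) = kron (A * C) (B * D) $$ (i, j)" .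
qed

lemma kron_adjoint:
  assumes A: "A \<in> carrier_mat a b" and B: "B \<in> carrier_mat c d"
  shows "mat_adjoint (kron A B) = kron (mat_adjoint A) (mat_adjoint B)"
proof (rule eq_matI)
  note car = mat_adjoint_carrier[OF kron_carrier[OF A B]]
    kron_carrier[OF mat_adjoint_carrier[OF A] mat_adjoint_carrier[OF B]]
  show "dim_row (mat_adjoint (kron A B)) = dim_row (kron (mat_adjoint A) (mat_adjoint B))"
    "dim_col (mat_adjoint (kron A B)) = dim_col (kron (mat_adjoint A) (mat_adjoint B))"
    using car by auto
  fix i j assume "i < dim_row (kron (mat_adjoint A) (mat_adjoint B))"
    "j < dim_col (kron (mat_adjoint A) (mat_adjoint B))"
  then have i: "i < b * d" and j: "j < a * c" using car by auto
  have i': "i div d < b" "i mod d < d" and j': "j div c < a" "j mod c < c"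
    using i j by (auto simp: less_mult_imp_div_less intro!: mod_less_divisor intro: gr0I)
  show "mat_adjoint (kron A B) $$ (i, j) = kron (mat_adjoint A) (mat_adjoint B) $$ (i, j)"
    using i j i' j'
    by (simp add: mat_adjoint_index[OF kron_carrier[OF A B]] kron_index[OF A B]
        kron_index[OF mat_adjoint_carrier[OF A] mat_adjoint_carrier[OF B]]
        mat_adjoint_index[OF A] mat_adjoint_index[OF B])
qed

lemma kron_one: "kron (1\<^sub>m a) (1\<^sub>m b) = 1\<^sub>m (a * b)"
proof (rule eq_matI)
  show "dim_row (kron (1\<^sub>m a) (1\<^sub>m b)) = dim_row (1\<^sub>m (a * b))"
    "dim_col (kron (1\<^sub>m a) (1\<^sub>m b)) = dim_col (1\<^sub>m (a * b))" by (simp_all add: kron_def)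
  fix i j assume "i < dim_row (1\<^sub>m (a * b) :: complex mat)" "j < dim_col (1\<^sub>m (a * b) :: complex mat)"
  then have i: "i < a * b" and j: "j < a * b" by auto
  have i': "i div b < a" "i mod b < b" and j': "j div b < a" "j mod b < b"
    using i j by (auto simp: less_mult_imp_div_less intro!: mod_less_divisor intro: gr0I)
  have "i = j \<longleftrightarrow> i div b = j div b \<and> i mod b = j mod b"
    by (metis div_mult_mod_eq)
  then show "kron (1\<^sub>m a) (1\<^sub>m b) $$ (i, j) = (1\<^sub>m (a * b) :: complex mat) $$ (i, j)"
    using i j i' j' by (simp add: kron_index[OF one_carrier_mat one_carrier_mat])
qed

lemma kron_add_left:
  assumes A: "A \<in> carrier_mat a b" and A': "A' \<in> carrier_mat a b" and B: "B \<in> carrier_mat c d"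
  shows "kron (A + A') B = kron A B + kron A' B"
  using assms by (intro eq_matI)
    (auto simp: kron_def algebra_simps less_mult_imp_div_less)

lemma kron_add_right:
  assumes A: "A \<in> carrier_mat a b" and B: "B \<in> carrier_mat c d" and B': "B' \<in> carrier_mat c d"
  shows "kron A (B + B') = kron A B + kron A B'"
proof (rule eq_matI)
  note car = kron_carrier[OF A B] kron_carrier[OF A B']
  have car': "kron A (B + B') \<in> carrier_mat (a * c) (b * d)"
    by (rule kron_carrier[OF A add_carrier_mat[OF B']])
  show "dim_row (kron A (B + B')) = dim_row (kron A B + kron A B')"
    "dim_col (kron A (B + B')) = dim_col (kron A B + kron A B')" using car car' by auto
  fix i j assume "i < dim_row (kron A B + kron A B')" "j < dim_col (kron A B + kron A B')"
  then have i: "i < a * c" and j: "j < b * d" using car by auto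
  have "i mod c < c" "j mod d < d"
    using i j by (auto intro!: mod_less_divisor intro: gr0I)
  then show "kron A (B + B') $$ (i, j) = (kron A B + kron A B') $$ (i, j)"
    using i j car B B'
    by (simp add: kron_index[OF A B] kron_index[OF A B'] kron_index[OF A add_carrier_mat[OF B']] algebra_simps)
qed

lemma kron_smult_left: "kron (k \<cdot>\<^sub>m A) B = k \<cdot>\<^sub>m kron A B"
  by (intro eq_matI) (auto simp: kron_def less_mult_imp_div_less)

lemma kron_smult_right:
  assumes A: "A \<in> carrier_mat a b" and B: "B \<in> carrier_mat c d"
  shows "kron A (k \<cdot>\<^sub>m B) = k \<cdot>\<^sub>m kron A B"
proof (rule eq_matI)
  note car = kron_carrier[OF A B]
  have car': "kron A (k \<cdot>\<^sub>m B) \<in> carrier_mat (a * c) (b * d)"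
    by (rule kron_carrier[OF A smult_carrier_mat[OF B]])
  show "dim_row (kron A (k \<cdot>\<^sub>m B)) = dim_row (k \<cdot>\<^sub>m kron A B)"
    "dim_col (kron A (k \<cdot>\<^sub>m B)) = dim_col (k \<cdot>\<^sub>m kron A B)" using car car' by auto
  fix i j assume "i < dim_row (k \<cdot>\<^sub>m kron A B)" "j < dim_col (k \<cdot>\<^sub>m kron A B)"
  then have i: "i < a * c" and j: "j < b * d" using car by auto
  have "i mod c < c" "j mod d < d"
    using i j by (auto intro!: mod_less_divisor intro: gr0I)
  then show "kron A (k \<cdot>\<^sub>m B) $$ (i, j) = (k \<cdot>\<^sub>m kron A B) $$ (i, j)"
    using i j car B
    by (simp add: kron_index[OF A B] kron_index[OF A smult_carrier_mat[OF B]])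
qed

section \<open>Tensor products of single-qubit matrices\<close>

text \<open>Tensor products over an arbitrary list of qubits, so that the structural facts about \<open>tensor\<close>
  can be proved by induction on that list.\<close>

definition kron_list :: "'i list \<Rightarrow> ('i \<Rightarrow> complex mat) \<Rightarrow> complex mat" where
  "kron_list xs A = foldr kron (map A xs) (1\<^sub>m 1)"

lemma kron_list_simps [simp]:
  "kron_list [] A = 1\<^sub>m 1" "kron_list (x # xs) A = kron (A x) (kron_list xs A)"
  by (simp_all add: kron_list_def)

lemma kron_list_carrier:
  "(\<And>i. i \<in> set xs \<Longrightarrow> A i \<in> carrier_mat 2 2)
    \<Longrightarrow> kron_list xs A \<in> carrier_mat (2 ^ length xs) (2 ^ length xs)"
  by (induction xs) auto

lemma kron_list_mult:
  "(\<And>i. i \<in> set xs \<Longrightarrow> A i \<in> carrier_mat 2 2) \<Longrightarrow> (\<And>i. i \<in> set xs \<Longrightarrow> B i \<in> carrier_mat 2 2)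
    \<Longrightarrow> kron_list xs A * kron_list xs B = kron_list xs (\<lambda>i. A i * B i)"
proof (induction xs)
  case (Cons x xs)
  have "kron (A x) (kron_list xs A) * kron (B x) (kron_list xs B)
      = kron (A x * B x) (kron_list xs A * kron_list xs B)"
    by (rule kron_mult[where a = 2 and b = 2 and e = 2, OF _ kron_list_carrier _ kron_list_carrier]) (auto simp: Cons.prems)
  then show ?case using Cons by simp
qed simp

lemma kron_list_one: "kron_list xs (\<lambda>_. 1\<^sub>m 2) = 1\<^sub>m (2 ^ length xs)"
  by (induction xs) (simp_all add: kron_one)

lemma mat_adjoint_one: "mat_adjoint (1\<^sub>m n :: complex mat) = 1\<^sub>m n"
  using mat_adjoint_carrier[OF one_carrier_mat, of n]
  by (intro eq_matI) (auto simp: mat_adjoint_index[OF one_carrier_mat])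

lemma kron_list_adjoint:
  "(\<And>i. i \<in> set xs \<Longrightarrow> A i \<in> carrier_mat 2 2)
    \<Longrightarrow> mat_adjoint (kron_list xs A) = kron_list xs (\<lambda>i. mat_adjoint (A i))"
proof (induction xs)
  case (Cons x xs)
  have "mat_adjoint (kron (A x) (kron_list xs A)) = kron (mat_adjoint (A x)) (mat_adjoint (kron_list xs A))"
    by (rule kron_adjoint[OF _ kron_list_carrier]) (auto simp: Cons.prems)
  then show ?case using Cons by simp
qed (simp add: mat_adjoint_one)

lemma kron_list_00:
  "(\<And>i. i \<in> set xs \<Longrightarrow> A i \<in> carrier_mat 2 2)
    \<Longrightarrow> kron_list xs A $$ (0, 0) = (\<Prod>i\<leftarrow>xs. A i $$ (0, 0))"
proof (induction xs)
  case (Cons x xs)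
  have "kron (A x) (kron_list xs A) $$ (0, 0) = A x $$ (0 div 2 ^ length xs, 0 div 2 ^ length xs)
      * kron_list xs A $$ (0 mod 2 ^ length xs, 0 mod 2 ^ length xs)"
    by (rule kron_index[where a = 2 and b = 2, OF _ kron_list_carrier]) (auto simp: Cons.prems)
  then show ?case using Cons by simp
qed simp

lemma kron_list_cong: "(\<And>i. i \<in> set xs \<Longrightarrow> A i = B i) \<Longrightarrow> kron_list xs A = kron_list xs B"
  by (induction xs) auto

lemma kron_list_smult:
  assumes "distinct xs" "j \<in> set xs" "\<And>i. i \<in> set xs \<Longrightarrow> A i \<in> carrier_mat 2 2"
    "\<And>i. i \<in> set xs \<Longrightarrow> B i = (if i = j then c \<cdot>\<^sub>m A i else A i)"
  shows "kron_list xs B = c \<cdot>\<^sub>m kron_list xs A"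
  using assms
proof (induction xs)
  case (Cons x xs)
  show ?case
  proof (cases "x = j")
    case True
    then have "kron_list xs B = kron_list xs A" using Cons.prems by (intro kron_list_cong) auto
    then show ?thesis using True Cons.prems by (simp add: kron_smult_left)
  next
    case False
    then have "kron_list xs B = c \<cdot>\<^sub>m kron_list xs A" using Cons by auto
    then show ?thesis using False Cons.prems
      by (simp add: kron_smult_right[where a = 2 and b = 2, OF _ kron_list_carrier])
  qed
qed simp

lemma kron_list_add:
  assumes "distinct xs" "j \<in> set xs" "\<And>i. i \<in> set xs \<Longrightarrow> A i \<in> carrier_mat 2 2" "M \<in> carrier_mat 2 2"
    "\<And>i. i \<in> set xs \<Longrightarrow> B i = (if i = j then M else A i)"
    "\<And>i. i \<in> set xs \<Longrightarrow> C i = (if i = j then A i + M else A i)"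
  shows "kron_list xs C = kron_list xs A + kron_list xs B"
  using assms
proof (induction xs)
  case (Cons x xs)
  show ?case
  proof (cases "x = j")
    case True
    then have "kron_list xs B = kron_list xs A" "kron_list xs C = kron_list xs A"
      using Cons.prems by (auto intro!: kron_list_cong)
    then show ?thesis using True Cons.prems
      by (simp add: kron_add_left[where a = 2 and b = 2, OF _ _ kron_list_carrier])
  next
    case False
    then have "kron_list xs C = kron_list xs A + kron_list xs B" using Cons by auto
    moreover have "B x = A x" "C x = A x" using False Cons.prems by auto
    moreover have "B i \<in> carrier_mat 2 2" if "i \<in> set xs" for i using that Cons.prems by auto
    ultimately show ?thesis using Cons.prems
      by (simp add: kron_add_right[where a = 2 and b = 2, OF _ kron_list_carrier kron_list_carrier])
  qed
qed simp

lemma tensor_eq_kron_list: "tensor n A = kron_list [1..<Suc n] A"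
  by (simp add: tensor_def kron_list_def)

lemma tensor_carrier:
  assumes "\<And>i. i \<in> {1..n} \<Longrightarrow> A i \<in> carrier_mat 2 2"
  shows "tensor n A \<in> carrier_mat (2 ^ n) (2 ^ n)"
  using kron_list_carrier[of "[1..<Suc n]" A] assms by (simp add: tensor_eq_kron_list del: upt_Suc)

lemma tensor_mult:
  assumes "\<And>i. i \<in> {1..n} \<Longrightarrow> A i \<in> carrier_mat 2 2" "\<And>i. i \<in> {1..n} \<Longrightarrow> B i \<in> carrier_mat 2 2"
  shows "tensor n A * tensor n B = tensor n (\<lambda>i. A i * B i)"
  unfolding tensor_eq_kron_list by (rule kron_list_mult) (use assms in auto)

lemma tensor_cong:
  assumes "\<And>i. i \<in> {1..n} \<Longrightarrow> A i = B i"
  shows "tensor n A = tensor n B"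
  unfolding tensor_eq_kron_list by (rule kron_list_cong) (use assms in auto)

lemma tensor_one: "tensor n (\<lambda>_. 1\<^sub>m 2) = 1\<^sub>m (2 ^ n)"
  unfolding tensor_eq_kron_list kron_list_one by (simp del: upt_Suc)

lemma tensor_adjoint:
  assumes "\<And>i. i \<in> {1..n} \<Longrightarrow> A i \<in> carrier_mat 2 2"
  shows "mat_adjoint (tensor n A) = tensor n (\<lambda>i. mat_adjoint (A i))"
  unfolding tensor_eq_kron_list by (rule kron_list_adjoint) (use assms in auto)

lemma tensor_00:
  assumes "\<And>i. i \<in> {1..n} \<Longrightarrow> A i \<in> carrier_mat 2 2"
  shows "tensor n A $$ (0, 0) = (\<Prod>i = 1..n. A i $$ (0, 0))"
proof -
  have "tensor n A $$ (0, 0) = (\<Prod>i\<leftarrow>[1..<Suc n]. A i $$ (0, 0))"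
    unfolding tensor_eq_kron_list by (rule kron_list_00) (use assms in auto)
  also have "\<dots> = (\<Prod>i\<in>set [1..<Suc n]. A i $$ (0, 0))"
    by (rule prod.distinct_set_conv_list[symmetric]) simp
  also have "set [1..<Suc n] = {1..n}" by auto
  finally show ?thesis .
qed

lemma mult_carrier_22 [simp]:
  "A \<in> carrier_mat 2 2 \<Longrightarrow> B \<in> carrier_mat 2 2 \<Longrightarrow> A * B \<in> carrier_mat 2 2"
  by (rule mult_carrier_mat)

lemma smult_smult_mat: "a \<cdot>\<^sub>m (b \<cdot>\<^sub>m M) = (a * b) \<cdot>\<^sub>m (M :: complex mat)"
  by (intro eq_matI) auto

lemma one_smult_mat: "1 \<cdot>\<^sub>m M = (M :: complex mat)"
  by (intro eq_matI) auto

section \<open>One- and two-qubit observables\<close>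

definition pauli_Y :: "complex mat" where
  "pauli_Y = m22 0 (- \<i>) \<i> 0"

lemma gates_carrier [simp]:
  "pauli_X \<in> carrier_mat 2 2" "pauli_Y \<in> carrier_mat 2 2" "pauli_Z \<in> carrier_mat 2 2"
  "proj0 \<in> carrier_mat 2 2" "proj1 \<in> carrier_mat 2 2" "Ry t \<in> carrier_mat 2 2" "Rz t \<in> carrier_mat 2 2"
  by (simp_all add: pauli_X_def pauli_Y_def pauli_Z_def proj0_def proj1_def Ry_def Rz_def)

text \<open>Observables that act on at most two qubits. A CNOT gate is a sum of two of them, which is what makes
  conjugation by it computable.\<close>

definition two_site :: "nat \<Rightarrow> nat \<Rightarrow> nat \<Rightarrow> complex mat \<Rightarrow> complex mat \<Rightarrow> complex mat" where
  "two_site n j k A B = tensor n (\<lambda>i. if i = j then A else if i = k then B else 1\<^sub>m 2)"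

context
  fixes n j k :: nat
  assumes jk: "j \<in> {1..n}" "k \<in> {1..n}" "j \<noteq> k"
begin

lemma two_site_carrier:
  assumes "A \<in> carrier_mat 2 2" "B \<in> carrier_mat 2 2"
  shows "two_site n j k A B \<in> carrier_mat (2 ^ n) (2 ^ n)"
  unfolding two_site_def by (rule tensor_carrier) (use assms in auto)

lemma two_site_mult:
  assumes "A \<in> carrier_mat 2 2" "B \<in> carrier_mat 2 2" "C \<in> carrier_mat 2 2" "D \<in> carrier_mat 2 2"
  shows "two_site n j k A B * two_site n j k C D = two_site n j k (A * C) (B * D)"
  unfolding two_site_def
  by (subst tensor_mult) (use assms in \<open>auto intro!: tensor_cong\<close>)

lemma two_site_smult_left:
  assumes "A \<in> carrier_mat 2 2" "B \<in> carrier_mat 2 2"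
  shows "two_site n j k (c \<cdot>\<^sub>m A) B = c \<cdot>\<^sub>m two_site n j k A B"
  unfolding two_site_def tensor_eq_kron_list
  by (rule kron_list_smult[where j = j]) (use assms jk in auto)

lemma two_site_smult_right:
  assumes "A \<in> carrier_mat 2 2" "B \<in> carrier_mat 2 2"
  shows "two_site n j k A (c \<cdot>\<^sub>m B) = c \<cdot>\<^sub>m two_site n j k A B"
  unfolding two_site_def tensor_eq_kron_list
  by (rule kron_list_smult[where j = k]) (use assms jk in auto)

text \<open>Scalars can be moved from one tensor factor to the other. The conjugation rules below hold only
  after phases have been exchanged between the control and the target in this way.\<close>

lemma two_site_smult_cancel:
  assumes "A \<in> carrier_mat 2 2" "B \<in> carrier_mat 2 2" "a * b = 1"
  shows "two_site n j k (a \<cdot>\<^sub>m A) (b \<cdot>\<^sub>m B) = two_site n j k A B"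
  using assms by (simp add: two_site_smult_left two_site_smult_right smult_smult_mat one_smult_mat
      mult.commute[of b a])

lemma two_site_add_left:
  assumes "A \<in> carrier_mat 2 2" "A' \<in> carrier_mat 2 2" "B \<in> carrier_mat 2 2"
  shows "two_site n j k (A + A') B = two_site n j k A B + two_site n j k A' B"
  unfolding two_site_def tensor_eq_kron_list
  by (rule kron_list_add[where j = j and M = A']) (use assms jk in auto)

lemma two_site_one: "two_site n j k (1\<^sub>m 2) (1\<^sub>m 2) = 1\<^sub>m (2 ^ n)"
  unfolding two_site_def if_cancel by (rule tensor_one)

lemma two_site_adjoint:
  assumes "A \<in> carrier_mat 2 2" "B \<in> carrier_mat 2 2"
  shows "mat_adjoint (two_site n j k A B) = two_site n j k (mat_adjoint A) (mat_adjoint B)"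
  unfolding two_site_def
  by (subst tensor_adjoint) (use assms in \<open>auto intro!: tensor_cong simp: mat_adjoint_one\<close>)

lemma cnot_eq_two_site:
  "cnot n j k = two_site n j k proj0 (1\<^sub>m 2) + two_site n j k proj1 pauli_X"
  unfolding cnot_def two_site_def by (intro arg_cong2[where f = "(+)"] tensor_cong) auto

lemma cnot_carrier: "cnot n j k \<in> carrier_mat (2 ^ n) (2 ^ n)"
  unfolding cnot_eq_two_site by (intro add_carrier_mat two_site_carrier) simp_all

lemma two_site_mult_cnot:
  assumes "A \<in> carrier_mat 2 2" "B \<in> carrier_mat 2 2"
  shows "two_site n j k A B * cnot n j k
    = two_site n j k (A * proj0) B + two_site n j k (A * proj1) (B * pauli_X)"
  unfolding cnot_eq_two_site
  by (subst mult_add_distrib_mat[where n = "2 ^ n" and nr = "2 ^ n" and nc = "2 ^ n"])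
    (use assms in \<open>simp_all add: two_site_carrier two_site_mult\<close>)

lemma cnot_mult_two_site:
  assumes "A \<in> carrier_mat 2 2" "B \<in> carrier_mat 2 2"
  shows "cnot n j k * two_site n j k A B
    = two_site n j k (proj0 * A) B + two_site n j k (proj1 * A) (pauli_X * B)"
  unfolding cnot_eq_two_site
  by (subst add_mult_distrib_mat[where n = "2 ^ n" and nr = "2 ^ n" and nc = "2 ^ n"])
    (use assms in \<open>simp_all add: two_site_carrier two_site_mult\<close>)

text \<open>The key conjugation rule: a CNOT turns the observable X on its control and Y on its target into Y on
  its control and Z on its target. The weight stays on these two qubits, X on the control is not affected
  by an earlier gate that targets it, and Z on the target is not affected by a later gate that it
  controls. Since rotations turn the new observable back into X and Y, it can pass through arbitrarily many
  entangling operations without spreading.\<close>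

lemma cnot_cross_X_Y:
  "two_site n j k pauli_X pauli_Y * cnot n j k = cnot n j k * two_site n j k pauli_Y pauli_Z"
proof -
  let ?T = "two_site n j k"
  note [simp] = two_site_carrier
  have "?T (pauli_X * proj0) pauli_Y = ?T (proj1 * pauli_Y) (pauli_X * pauli_Z)"
  proof -
    have "pauli_X * proj0 = (- \<i>) \<cdot>\<^sub>m (proj1 * pauli_Y)" "pauli_Y = \<i> \<cdot>\<^sub>m (pauli_X * pauli_Z)"
      by (simp_all add: pauli_X_def pauli_Y_def pauli_Z_def proj0_def proj1_def)
    then have "?T (pauli_X * proj0) pauli_Y = ?T ((- \<i>) \<cdot>\<^sub>m (proj1 * pauli_Y)) (\<i> \<cdot>\<^sub>m (pauli_X * pauli_Z))"
      by (intro arg_cong2[where f = ?T])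
    then show ?thesis by (simp add: two_site_smult_cancel)
  qed
  moreover have "?T (pauli_X * proj1) (pauli_Y * pauli_X) = ?T (proj0 * pauli_Y) pauli_Z"
  proof -
    have "pauli_X * proj1 = \<i> \<cdot>\<^sub>m (proj0 * pauli_Y)" "pauli_Y * pauli_X = (- \<i>) \<cdot>\<^sub>m pauli_Z"
      by (simp_all add: pauli_X_def pauli_Y_def pauli_Z_def proj0_def proj1_def)
    then show ?thesis by (simp add: two_site_smult_cancel)
  qed
  ultimately show ?thesis
    by (simp add: two_site_mult_cnot cnot_mult_two_site comm_add_mat[where nr = "2 ^ n" and nc = "2 ^ n"])
qed

text \<open>For the first entangling operation, which the measured observable, Z on a single qubit, meets before
  any rotation can change it.\<close>

lemma cnot_cross_target_Z:
  "two_site n j k (1\<^sub>m 2) pauli_Z * cnot n j k = cnot n j k * two_site n j k pauli_Z pauli_Z"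
proof -
  have 1: "proj1 * pauli_Z = (- 1) \<cdot>\<^sub>m proj1" "pauli_X * pauli_Z = (- 1) \<cdot>\<^sub>m (pauli_Z * pauli_X)"
    "proj0 * pauli_Z = proj0"
    by (simp_all add: pauli_X_def pauli_Z_def proj0_def proj1_def)
  have "two_site n j k (proj1 * pauli_Z) (pauli_X * pauli_Z) = two_site n j k proj1 (pauli_Z * pauli_X)"
    unfolding 1 by (intro two_site_smult_cancel) simp_all
  then show ?thesis
    by (simp add: two_site_mult_cnot cnot_mult_two_site 1(3)
        left_mult_one_mat[of proj0 2 2] left_mult_one_mat[of proj1 2 2])
qed

lemma cnot_unitary: "mat_adjoint (cnot n j k) * cnot n j k = 1\<^sub>m (2 ^ n)"
proof -
  note [simp] = two_site_carrier
  let ?T = "two_site n j k"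
  have "mat_adjoint proj0 = proj0" "mat_adjoint proj1 = proj1" "mat_adjoint pauli_X = pauli_X"
    by (simp_all add: pauli_X_def proj0_def proj1_def)
  then have "mat_adjoint (cnot n j k) = cnot n j k"
    unfolding cnot_eq_two_site
    by (subst mat_adjoint_add[where m = "2 ^ n" and n = "2 ^ n"])
      (simp_all add: two_site_adjoint mat_adjoint_one)
  then have "mat_adjoint (cnot n j k) * cnot n j k
      = ?T proj0 (1\<^sub>m 2) * cnot n j k + ?T proj1 pauli_X * cnot n j k"
    using add_mult_distrib_mat[of "?T proj0 (1\<^sub>m 2)" "2 ^ n" "2 ^ n" "?T proj1 pauli_X" "cnot n j k" "2 ^ n"]
      cnot_carrier by (simp add: cnot_eq_two_site[symmetric])
  also have "\<dots> = (?T proj0 (1\<^sub>m 2) + ?T (0 \<cdot>\<^sub>m proj0) pauli_X) + (?T (0 \<cdot>\<^sub>m proj1) pauli_X + ?T proj1 (1\<^sub>m 2))"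
  proof -
    have "proj0 * proj0 = proj0" "proj1 * proj1 = proj1" "proj0 * proj1 = 0 \<cdot>\<^sub>m proj0"
      "proj1 * proj0 = 0 \<cdot>\<^sub>m proj1" "pauli_X * pauli_X = 1\<^sub>m 2"
      by (simp_all add: pauli_X_def proj0_def proj1_def m22_one)
    then show ?thesis by (simp add: two_site_mult_cnot left_mult_one_mat[of pauli_X 2 2])
  qed
  also have "\<dots> = ?T (proj0 + proj1) (1\<^sub>m 2)"
  proof -
    have "M + 0 \<cdot>\<^sub>m N + (0 \<cdot>\<^sub>m K + P) = M + P"
      if "M \<in> carrier_mat (2 ^ n) (2 ^ n)" "N \<in> carrier_mat (2 ^ n) (2 ^ n)"
        "K \<in> carrier_mat (2 ^ n) (2 ^ n)" "P \<in> carrier_mat (2 ^ n) (2 ^ n)" for M N K P :: "complex mat"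
      using that by (intro eq_matI) auto
    then show ?thesis
      by (simp only: two_site_smult_left two_site_add_left gates_carrier one_carrier_mat two_site_carrier)
  qed
  also have "proj0 + proj1 = 1\<^sub>m 2"
    by (simp add: proj0_def proj1_def m22_one)
  finally show ?thesis by (simp add: two_site_one)
qed

text \<open>Both product terms of a CNOT have only a projection on the control qubit and the identity or X on the
  target qubit as their factors, and product operators commute if they do so factor by factor.\<close>

lemma tensor_commute_cnot:
  assumes A: "\<And>i. i \<in> {1..n} \<Longrightarrow> A i \<in> carrier_mat 2 2"
    and 0: "A j * proj0 = proj0 * A j" and 1: "A j * proj1 = proj1 * A j"
    and X: "A k * pauli_X = pauli_X * A k"
  shows "tensor n A * cnot n j k = cnot n j k * tensor n A"
proof -
  have a: "tensor n A * two_site n j k M N = two_site n j k M N * tensor n A"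
    if "M \<in> carrier_mat 2 2" "N \<in> carrier_mat 2 2" "A j * M = M * A j" "A k * N = N * A k" for M N
  proof -
    have "tensor n A * two_site n j k M N = tensor n (\<lambda>i. A i * (if i = j then M else if i = k then N else 1\<^sub>m 2))"
      unfolding two_site_def by (rule tensor_mult) (use A that in auto)
    also have "\<dots> = tensor n (\<lambda>i. (if i = j then M else if i = k then N else 1\<^sub>m 2) * A i)"
      by (rule tensor_cong)
        (use that in \<open>auto simp: left_mult_one_mat[OF A] right_mult_one_mat[OF A]\<close>)
    also have "\<dots> = two_site n j k M N * tensor n A"
      unfolding two_site_def by (rule tensor_mult[symmetric]) (use A that in auto)
    finally show ?thesis .
  qed
  have "A k * 1\<^sub>m 2 = 1\<^sub>m 2 * A k" using A[OF jk(2)] by simp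
  then show ?thesis
    unfolding cnot_eq_two_site
    using tensor_carrier[of n A, OF A]
    by (subst mult_add_distrib_mat[where n = "2 ^ n" and nr = "2 ^ n" and nc = "2 ^ n"])
      (simp_all add: two_site_carrier a 0 1 X
        add_mult_distrib_mat[where n = "2 ^ n" and nr = "2 ^ n" and nc = "2 ^ n"])
qed

end

section \<open>Unitary circuits and the Heisenberg picture\<close>

definition unitary_mat :: "nat \<Rightarrow> complex mat \<Rightarrow> bool" where
  "unitary_mat N U \<longleftrightarrow> U \<in> carrier_mat N N \<and> mat_adjoint U * U = 1\<^sub>m N"

lemma unitary_mat_one: "unitary_mat N (1\<^sub>m N)"
  by (simp add: unitary_mat_def mat_adjoint_one)

lemma unitary_mat_mult:
  assumes "unitary_mat N U" "unitary_mat N V"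
  shows "unitary_mat N (U * V)"
proof -
  have U: "U \<in> carrier_mat N N" "mat_adjoint U * U = 1\<^sub>m N"
    and V: "V \<in> carrier_mat N N" "mat_adjoint V * V = 1\<^sub>m N"
    using assms by (auto simp: unitary_mat_def)
  note a = mat_adjoint_carrier[OF U(1)] mat_adjoint_carrier[OF V(1)]
  have "mat_adjoint (U * V) * (U * V) = mat_adjoint V * (mat_adjoint U * (U * V))"
    unfolding mat_adjoint_mult[OF U(1) V(1)]
    by (rule assoc_mult_mat[OF a(2) a(1) mult_carrier_mat[OF U(1) V(1)]])
  also have "mat_adjoint U * (U * V) = mat_adjoint U * U * V"
    by (rule assoc_mult_mat[OF a(1) U(1) V(1), symmetric])
  finally show ?thesis using U V by (simp add: unitary_mat_def)
qed

lemma tensor_unitary: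
  assumes "\<And>i. i \<in> {1..n} \<Longrightarrow> unitary_mat 2 (A i)"
  shows "unitary_mat (2 ^ n) (tensor n A)"
proof -
  have c: "A i \<in> carrier_mat 2 2" if "i \<in> {1..n}" for i
    using assms[OF that] by (simp add: unitary_mat_def)
  have "mat_adjoint (tensor n A) * tensor n A = tensor n (\<lambda>i. mat_adjoint (A i) * A i)"
    by (subst tensor_adjoint, use c in simp, rule tensor_mult) (use c mat_adjoint_carrier[OF c] in auto)
  also have "\<dots> = tensor n (\<lambda>_. 1\<^sub>m 2)"
    by (rule tensor_cong) (use assms in \<open>simp add: unitary_mat_def\<close>)
  finally show ?thesis
    using tensor_carrier[of n A, OF c] by (simp add: unitary_mat_def tensor_one)
qed

lemma foldr_mult_mat:
  assumes "\<And>X. X \<in> set Xs \<Longrightarrow> X \<in> carrier_mat N N" "(M :: complex mat) \<in> carrier_mat N N"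
  shows "foldr (*) Xs (1\<^sub>m N) \<in> carrier_mat N N \<and> foldr (*) Xs M = foldr (*) Xs (1\<^sub>m N) * M"
  using assms(1)
proof (induction Xs)
  case (Cons X Xs)
  then have "X \<in> carrier_mat N N" "foldr (*) Xs (1\<^sub>m N) \<in> carrier_mat N N" by auto
  moreover from this have "X * foldr (*) Xs (1\<^sub>m N) \<in> carrier_mat N N" by (rule mult_carrier_mat)
  ultimately show ?case using Cons assms(2) by (auto simp: assoc_mult_mat[of _ N N _ N _ N])
qed (use assms(2) in auto)

lemma ordered_prod_0 [simp]: "ordered_prod N 0 F = 1\<^sub>m N"
  by (simp add: ordered_prod_def)

lemma ordered_prod_Suc:
  assumes "\<And>l. l \<in> {1..Suc m} \<Longrightarrow> F l \<in> carrier_mat N N"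
  shows "ordered_prod N (Suc m) F = ordered_prod N m F * F (Suc m)"
proof -
  have "foldr (*) (map F [1..<Suc m]) (F (Suc m)) = foldr (*) (map F [1..<Suc m]) (1\<^sub>m N) * F (Suc m)"
    by (rule conjunct2[OF foldr_mult_mat]) (use assms in auto)
  moreover have "F (Suc m) * 1\<^sub>m N = F (Suc m)"
    using assms[of "Suc m"] by auto
  ultimately show ?thesis by (simp add: ordered_prod_def)
qed

lemma ordered_prod_carrier:
  assumes "\<And>l. l \<in> {1..m} \<Longrightarrow> F l \<in> carrier_mat N N"
  shows "ordered_prod N m F \<in> carrier_mat N N"
  unfolding ordered_prod_def
  by (rule conjunct1[OF foldr_mult_mat[where M = "1\<^sub>m N"]]) (use assms in auto)

lemma ordered_prod_unitary:
  "(\<And>l. l \<in> {1..m} \<Longrightarrow> unitary_mat N (F l)) \<Longrightarrow> unitary_mat N (ordered_prod N m F)"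
proof (induction m)
  case (Suc m)
  have "ordered_prod N (Suc m) F = ordered_prod N m F * F (Suc m)"
    by (rule ordered_prod_Suc) (use Suc.prems in \<open>simp add: unitary_mat_def\<close>)
  then show ?case using Suc by (simp add: unitary_mat_mult)
qed (simp add: unitary_mat_one)

text \<open>Heisenberg picture: an equation A * U = U * B says that conjugation by U turns the observable A into B.
  Such equations compose along products of gates.\<close>

lemma intertwine_mult:
  assumes "A * U = U * B" "B * V = V * C"
    and c: "A \<in> carrier_mat N N" "B \<in> carrier_mat N N" "C \<in> carrier_mat N N"
      "U \<in> carrier_mat N N" "(V :: complex mat) \<in> carrier_mat N N"
  shows "A * (U * V) = U * V * C"
proof -
  have "A * (U * V) = A * U * V" using c by (simp add: assoc_mult_mat[of _ N N _ N _ N])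
  also have "\<dots> = U * (B * V)" unfolding assms(1) using c by (simp add: assoc_mult_mat[of _ N N _ N _ N])
  also have "\<dots> = U * V * C" unfolding assms(2) using c by (simp add: assoc_mult_mat[of _ N N _ N _ N])
  finally show ?thesis .
qed

text \<open>The factor with the smallest index stands leftmost and hence meets the observable first.\<close>

lemma ordered_prod_intertwine:
  assumes "\<And>l. l < m \<Longrightarrow> A l * F (Suc l) = F (Suc l) * A (Suc l)"
    and "\<And>l. l \<in> {1..m} \<Longrightarrow> F l \<in> carrier_mat N N"
    and "\<And>l. l \<le> m \<Longrightarrow> A l \<in> carrier_mat N N"
  shows "A 0 * ordered_prod N m F = ordered_prod N m F * A m"
  using assms
proof (induction m)
  case (Suc m)
  have "ordered_prod N (Suc m) F = ordered_prod N m F * F (Suc m)"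
    by (rule ordered_prod_Suc) (rule Suc.prems(2))
  moreover have "ordered_prod N m F \<in> carrier_mat N N"
    by (rule ordered_prod_carrier) (use Suc.prems(2) in auto)
  moreover have "A 0 * ordered_prod N m F = ordered_prod N m F * A m"
    by (rule Suc.IH) (use Suc.prems in auto)
  then have "A 0 * (ordered_prod N m F * F (Suc m)) = ordered_prod N m F * F (Suc m) * A (Suc m)"
    by (rule intertwine_mult[where N = N]) (use Suc.prems calculation in auto)
  ultimately show ?case by simp
qed simp

lemma cnot_is_unitary:
  assumes "j \<in> {1..n}" "k \<in> {1..n}" "j \<noteq> k"
  shows "unitary_mat (2 ^ n) (cnot n j k)"
  using cnot_unitary[OF assms] cnot_carrier[OF assms] by (simp add: unitary_mat_def)

lemma entangler_unitary: "n \<ge> 1 \<Longrightarrow> unitary_mat (2 ^ n) (entangler n)"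
  unfolding entangler_def
  by (auto intro!: unitary_mat_one unitary_mat_mult ordered_prod_unitary cnot_is_unitary)

context
  fixes n j k :: nat
  assumes jk: "2 \<le> j" "k = Suc j" "k \<le> n"
begin

lemma pair_in_range: "j \<in> {1..n}" "k \<in> {1..n}" "j \<noteq> k"
  using jk by auto

text \<open>In the Heisenberg picture the observable meets the gates of the chain in the order of increasing
  control qubit. Before the gate from j to k only the gate with target j touches it, and after that gate
  only the gate with control k does. The closing gate from n to 1 is harmless because qubit 1 is not one
  of the two qubits, which is why pairs start at qubit 2.\<close>

lemma entangler_intertwine:
  assumes c: "A \<in> carrier_mat 2 2" "B \<in> carrier_mat 2 2" "A' \<in> carrier_mat 2 2" "B' \<in> carrier_mat 2 2"
    and X: "A * pauli_X = pauli_X * A"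
    and 0: "B' * proj0 = proj0 * B'" and 1: "B' * proj1 = proj1 * B'"
    and cross: "two_site n j k A B * cnot n j k = cnot n j k * two_site n j k A' B'"
  shows "two_site n j k A B * entangler n = entangler n * two_site n j k A' B'"
proof -
  note tc = two_site_carrier[OF pair_in_range]
  note one = left_mult_one_mat[of _ 2 2] right_mult_one_mat[of _ 2 2]
  \<comment> \<open>\<open>S l\<close> is the observable after the first l gates; it changes at gate j, the one from j to k.\<close>
  define S where "S l = (if l < j then two_site n j k A B else two_site n j k A' B')" for l
  have "S 0 * ordered_prod (2 ^ n) (n - 1) (\<lambda>k. cnot n k (k + 1))
      = ordered_prod (2 ^ n) (n - 1) (\<lambda>k. cnot n k (k + 1)) * S (n - 1)"
  proof (rule ordered_prod_intertwine)
    fix l assume l: "l < n - 1"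
    have r: "Suc l \<in> {1..n}" "Suc l + 1 \<in> {1..n}" "Suc l \<noteq> Suc l + 1" using l by auto
    consider "Suc l < j" | "Suc l = j" | "Suc l > j" by linarith
    then show "S l * cnot n (Suc l) (Suc l + 1) = cnot n (Suc l) (Suc l + 1) * S (Suc l)"
    proof cases
      case 1
      then have "S l = two_site n j k A B" "S (Suc l) = two_site n j k A B" by (auto simp: S_def)
      then show ?thesis
        using tensor_commute_cnot[OF r, of "\<lambda>i. if i = j then A else if i = k then B else 1\<^sub>m 2"] 1 jk c X
        by (auto simp: two_site_def one)
    next
      case 2
      then show ?thesis using cross jk by (auto simp: S_def)
    next
      case 3
      then have "S l = two_site n j k A' B'" "S (Suc l) = two_site n j k A' B'" by (auto simp: S_def)
      then show ?thesis
        using tensor_commute_cnot[OF r, of "\<lambda>i. if i = j then A' else if i = k then B' else 1\<^sub>m 2"] 3 jk c 0 1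
        by (auto simp: two_site_def one)
    qed
  next
    fix l assume "l \<in> {1..n - 1}"
    then show "cnot n l (l + 1) \<in> carrier_mat (2 ^ n) (2 ^ n)" by (intro cnot_carrier) auto
  qed (auto simp: S_def tc c)
  moreover have "S 0 = two_site n j k A B" "S (n - 1) = two_site n j k A' B'"
    using jk by (auto simp: S_def)
  moreover have "two_site n j k A' B' * cnot n n 1 = cnot n n 1 * two_site n j k A' B'"
  proof -
    have r: "n \<in> {1..n}" "1 \<in> {1..n}" "n \<noteq> 1" using jk by auto
    show ?thesis
      using tensor_commute_cnot[OF r, of "\<lambda>i. if i = j then A' else if i = k then B' else 1\<^sub>m 2"] jk c 0 1
      by (auto simp: two_site_def one)
  qed
  moreover have "ordered_prod (2 ^ n) (n - 1) (\<lambda>k. cnot n k (k + 1)) \<in> carrier_mat (2 ^ n) (2 ^ n)"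
    by (intro ordered_prod_carrier cnot_carrier) auto
  moreover have "cnot n n 1 \<in> carrier_mat (2 ^ n) (2 ^ n)"
    using jk by (intro cnot_carrier) auto
  ultimately have "two_site n j k A B * (ordered_prod (2 ^ n) (n - 1) (\<lambda>k. cnot n k (k + 1)) * cnot n n 1)
      = ordered_prod (2 ^ n) (n - 1) (\<lambda>k. cnot n k (k + 1)) * cnot n n 1 * two_site n j k A' B'"
    by (intro intertwine_mult[where N = "2 ^ n" and B = "two_site n j k A' B'"])
      (simp_all only: tc c)
  then show ?thesis using jk by (simp add: entangler_def)
qed

lemma rotations_intertwine:
  assumes c: "A \<in> carrier_mat 2 2" "B \<in> carrier_mat 2 2" "A' \<in> carrier_mat 2 2" "B' \<in> carrier_mat 2 2"
    and R: "\<And>i. i \<in> {1..n} \<Longrightarrow> R i \<in> carrier_mat 2 2"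
    and "A * R j = R j * A'" "B * R k = R k * B'"
  shows "two_site n j k A B * tensor n R = tensor n R * two_site n j k A' B'"
proof -
  have "two_site n j k A B * tensor n R = tensor n (\<lambda>i. (if i = j then A else if i = k then B else 1\<^sub>m 2) * R i)"
    unfolding two_site_def by (rule tensor_mult) (use c R in auto)
  also have "\<dots> = tensor n (\<lambda>i. R i * (if i = j then A' else if i = k then B' else 1\<^sub>m 2))"
    by (rule tensor_cong) (use assms in \<open>auto simp: left_mult_one_mat[OF R] right_mult_one_mat[OF R]\<close>)
  also have "\<dots> = tensor n R * two_site n j k A' B'"
    unfolding two_site_def by (rule tensor_mult[symmetric]) (use c R in auto)
  finally show ?thesis .
qed

end

section \<open>Single-qubit rotations\<close>

definition rotation :: "real \<times> real \<times> real \<Rightarrow> complex mat" where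
  "rotation p = (case p of (\<alpha>, \<beta>, \<gamma>) \<Rightarrow> Rz \<gamma> * Ry \<beta> * Rz \<alpha>)"

lemma layer_eq: "layer n G = entangler n * tensor n (\<lambda>i. rotation (G i))"
  by (simp add: layer_def rotation_def)

lemma Ry_unitary: "unitary_mat 2 (Ry t)"
  unfolding unitary_mat_def
  by (simp add: Ry_def m22_one flip: of_real_mult of_real_add)
     (simp flip: power2_eq_square)

lemma Rz_unitary: "unitary_mat 2 (Rz t)"
  unfolding unitary_mat_def
  by (simp add: Rz_def m22_one exp_cnj flip: exp_add)

lemma rotation_unitary: "unitary_mat 2 (rotation p)"
  by (cases p) (auto simp: rotation_def intro!: unitary_mat_mult Ry_unitary Rz_unitary)

lemma layer_unitary: "n \<ge> 1 \<Longrightarrow> unitary_mat (2 ^ n) (layer n G)"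
  unfolding layer_eq by (intro unitary_mat_mult entangler_unitary tensor_unitary rotation_unitary)

lemma rotation_carrier [simp]: "rotation p \<in> carrier_mat 2 2"
  using rotation_unitary by (simp add: unitary_mat_def)

lemma Rz_0: "Rz 0 = 1\<^sub>m 2"
  by (simp add: Rz_def m22_one)

lemma Ry_0: "Ry 0 = 1\<^sub>m 2"
  by (simp add: Ry_def m22_one)

lemma rotation_0: "rotation (0, 0, 0) = 1\<^sub>m 2"
  by (simp add: rotation_def Rz_0 Ry_0)

text \<open>The common value of the sine and cosine of \<open>pi / 4\<close> cancels from the conjugation rules below, so it
  is kept abstract. The same applies to the phase in the next lemma.\<close>

lemma Ry_minus_half_pi: "\<exists>c. Ry (- (pi / 2)) = m22 c c (- c) c"
proof -
  have "sin (pi / 2 / 2) = cos (pi / 2 / 2)"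
    by (simp add: sin_45 cos_45)
  then show ?thesis by (auto simp: Ry_def)
qed

lemma Rz_minus_half_pi: "\<exists>w. Rz (- (pi / 2)) = m22 (\<i> * w) 0 0 w"
proof -
  have "exp (\<i> * complex_of_real (pi / 4)) = \<i> * exp (- (\<i> * complex_of_real (pi / 4)))"
  proof -
    have "\<i> * exp (- (\<i> * complex_of_real (pi / 4))) = exp (\<i> * complex_of_real (pi / 2)) * exp (- (\<i> * complex_of_real (pi / 4)))"
      using cis_pi_half by (simp add: cis_conv_exp)
    also have "\<dots> = exp (\<i> * complex_of_real (pi / 4))"
      by (simp add: field_simps flip: exp_add)
    finally show ?thesis by simp
  qed
  then show ?thesis by (intro exI[of _ "exp (- (\<i> * complex_of_real (pi / 4)))"]) (simp add: Rz_def)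
qed

lemma Z_to_X: "pauli_Z * rotation (0, - (pi / 2), 0) = rotation (0, - (pi / 2), 0) * pauli_X"
proof -
  obtain c where "Ry (- (pi / 2)) = m22 c c (- c) c" using Ry_minus_half_pi by blast
  then show ?thesis by (simp add: rotation_def Rz_0 m22_one pauli_Z_def pauli_X_def)
qed

lemma Z_to_Y: "pauli_Z * rotation (- (pi / 2), - (pi / 2), 0) = rotation (- (pi / 2), - (pi / 2), 0) * pauli_Y"
proof -
  obtain c where "Ry (- (pi / 2)) = m22 c c (- c) c" using Ry_minus_half_pi by blast
  moreover obtain w where "Rz (- (pi / 2)) = m22 (\<i> * w) 0 0 w" using Rz_minus_half_pi by blast
  ultimately show ?thesis by (simp add: rotation_def Rz_0 m22_one pauli_Z_def pauli_Y_def algebra_simps)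
qed

lemma Y_to_X: "pauli_Y * rotation (pi / 2, 0, 0) = rotation (pi / 2, 0, 0) * pauli_X"
proof -
  obtain w where w: "Rz (- (pi / 2)) = m22 (\<i> * w) 0 0 w" using Rz_minus_half_pi by blast
  have "Rz (pi / 2) = m22 (Rz (- (pi / 2)) $$ (Suc 0, Suc 0)) 0 0 (Rz (- (pi / 2)) $$ (0, 0))"
    by (simp add: Rz_def)
  then have "Rz (pi / 2) = m22 w 0 0 (\<i> * w)"
    unfolding w by simp
  then show ?thesis by (simp add: rotation_def Rz_0 Ry_0 m22_one pauli_X_def pauli_Y_def algebra_simps)
qed

section \<open>Expectations of the trained circuit\<close>

text \<open>The rotations of layer l on qubit i, where every even qubit j is paired with k = j + 1. Conjugation by
  the entangling operation leaves an observable with Z on qubit k, and with Z (first layer) or Y (later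
  layers) on qubit j. The rotations turn it back into X on j and Y on k, the form that survives the next
  entangling operation. Only in the last layer, where no further one follows, Z on k is kept, because
  its expectation in a state rotated by the feature map is a cosine.\<close>

definition pair_angles :: "nat \<Rightarrow> nat \<Rightarrow> nat \<Rightarrow> real \<times> real \<times> real" where
  "pair_angles L l i =
     (if even i then (if l = 1 then (0, - (pi / 2), 0) else (pi / 2, 0, 0))
      else (if l = L then (0, 0, 0) else (- (pi / 2), - (pi / 2), 0)))"

lemma variational_unitary: "n \<ge> 1 \<Longrightarrow> unitary_mat (2 ^ n) (variational n L \<Gamma>)"
  unfolding variational_def by (intro ordered_prod_unitary layer_unitary)

lemma feature_map_unitary: "unitary_mat (2 ^ n) (feature_map n a b x)"
  unfolding feature_map_def by (intro tensor_unitary Ry_unitary)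

context
  fixes n j k :: nat
  assumes jk: "2 \<le> j" "k = Suc j" "k \<le> n"
begin

lemma layer_intertwine:
  assumes c: "A \<in> carrier_mat 2 2" "B \<in> carrier_mat 2 2" "A' \<in> carrier_mat 2 2" "B' \<in> carrier_mat 2 2"
      "A'' \<in> carrier_mat 2 2" "B'' \<in> carrier_mat 2 2"
    and X: "A * pauli_X = pauli_X * A"
    and 0: "B' * proj0 = proj0 * B'" and 1: "B' * proj1 = proj1 * B'"
    and cross: "two_site n j k A B * cnot n j k = cnot n j k * two_site n j k A' B'"
    and R: "A' * rotation (G j) = rotation (G j) * A''" "B' * rotation (G k) = rotation (G k) * B''"
  shows "two_site n j k A B * layer n G = layer n G * two_site n j k A'' B''"
proof -
  note r = pair_in_range[OF jk]
  have "unitary_mat (2 ^ n) (entangler n)" "unitary_mat (2 ^ n) (tensor n (\<lambda>i. rotation (G i)))"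
    using jk by (auto intro!: entangler_unitary tensor_unitary rotation_unitary)
  then show ?thesis
    unfolding layer_eq
    by (intro intertwine_mult[where N = "2 ^ n" and B = "two_site n j k A' B'"]
        entangler_intertwine[OF jk] rotations_intertwine[OF jk] two_site_carrier[OF r] assms rotation_carrier)
      (auto simp: unitary_mat_def)
qed

text \<open>By the choice of the angles only three observables occur along the circuit, whatever its depth: Z on k
  before the first layer, X on j and Y on k between two layers, X on j and Z on k after the last one.\<close>

lemma variational_intertwine:
  assumes "even j" "L \<ge> 1"
  shows "Z_on n k * variational n L (pair_angles L) = variational n L (pair_angles L) * two_site n j k pauli_X pauli_Z"
proof -
  note r = pair_in_range[OF jk]
  \<comment> \<open>\<open>A l\<close> on qubit j and \<open>B l\<close> on qubit k form the observable after the first l layers.\<close>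
  define A where "A l = (if l = 0 then 1\<^sub>m 2 else pauli_X)" for l :: nat
  define B where "B l = (if l = 0 \<or> l = L then pauli_Z else pauli_Y)" for l
  have c: "A l \<in> carrier_mat 2 2" "B l \<in> carrier_mat 2 2" for l
    by (auto simp: A_def B_def)
  have comm: "pauli_Z * proj0 = proj0 * pauli_Z" "pauli_Z * proj1 = proj1 * pauli_Z"
    by (simp_all add: pauli_Z_def proj0_def proj1_def)
  have k: "odd k" using assms jk by simp
  have Rk: "pauli_Z * rotation (pair_angles L (Suc l) k) = rotation (pair_angles L (Suc l) k) * B (Suc l)" for l
    using k Z_to_Y by (auto simp: pair_angles_def B_def rotation_0 left_mult_one_mat[of _ 2 2] right_mult_one_mat[of _ 2 2])
  have "two_site n j k (A 0) (B 0) * ordered_prod (2 ^ n) L (\<lambda>l. layer n (pair_angles L l))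
      = ordered_prod (2 ^ n) L (\<lambda>l. layer n (pair_angles L l)) * two_site n j k (A L) (B L)"
  proof (rule ordered_prod_intertwine)
    fix l assume l: "l < L"
    show "two_site n j k (A l) (B l) * layer n (pair_angles L (Suc l))
        = layer n (pair_angles L (Suc l)) * two_site n j k (A (Suc l)) (B (Suc l))"
    proof (cases "l = 0")
      case True
      show ?thesis
      proof (rule layer_intertwine[where A' = pauli_Z and B' = pauli_Z])
        show "A l * pauli_X = pauli_X * A l"
          using True by (simp add: A_def left_mult_one_mat[of _ 2 2] right_mult_one_mat[of _ 2 2])
        show "two_site n j k (A l) (B l) * cnot n j k = cnot n j k * two_site n j k pauli_Z pauli_Z"
          using True cnot_cross_target_Z[OF r] by (simp add: A_def B_def)
        show "pauli_Z * rotation (pair_angles L (Suc l) j) = rotation (pair_angles L (Suc l) j) * A (Suc l)"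
          using True assms Z_to_X by (simp add: A_def pair_angles_def)
      qed (use c comm Rk in auto)
    next
      case False
      show ?thesis
      proof (rule layer_intertwine[where A' = pauli_Y and B' = pauli_Z])
        show "A l * pauli_X = pauli_X * A l"
          using False by (simp add: A_def)
        show "two_site n j k (A l) (B l) * cnot n j k = cnot n j k * two_site n j k pauli_Y pauli_Z"
          using False l cnot_cross_X_Y[OF r] by (simp add: A_def B_def)
        show "pauli_Y * rotation (pair_angles L (Suc l) j) = rotation (pair_angles L (Suc l) j) * A (Suc l)"
          using False assms Y_to_X by (simp add: A_def pair_angles_def)
      qed (use c comm Rk in auto)
    qed
  next
    show "layer n (pair_angles L l) \<in> carrier_mat (2 ^ n) (2 ^ n)" for l
      using jk layer_unitary[of n "pair_angles L l"] by (simp add: unitary_mat_def)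
  qed (auto intro!: two_site_carrier[OF r] c)
  moreover have "Z_on n k = two_site n j k (A 0) (B 0)"
    unfolding Z_on_def two_site_def using jk by (intro tensor_cong) (auto simp: A_def B_def)
  moreover have "A L = pauli_X" "B L = pauli_Z"
    using assms by (auto simp: A_def B_def)
  ultimately show ?thesis by (simp add: variational_def)
qed

text \<open>The feature map prepares a product state, so the expectation of the product observable factors. The
  X-expectation of a qubit rotated by the angle z is \<open>sin z\<close>, its Z-expectation is \<open>cos z\<close>.\<close>

lemma expectation_Z_eq:
  assumes "even j" "L \<ge> 1"
  shows "expectation_Z n L a b (pair_angles L) k x
    = complex_of_real (sin (inner (a j) x + b j) * cos (inner (a k) x + b k))"
proof -
  note r = pair_in_range[OF jk]
  let ?N = "2 ^ n :: nat"
  let ?V = "variational n L (pair_angles L)" and ?F = "feature_map n a b x"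
  let ?T = "two_site n j k pauli_X pauli_Z"
  let ?z = "\<lambda>i. inner (a i) x + b i"
  define P where "P i = (if i = j then pauli_X else if i = k then pauli_Z else 1\<^sub>m 2)" for i
  have P: "P i \<in> carrier_mat 2 2" for i by (simp add: P_def)
  have V: "?V \<in> carrier_mat ?N ?N" "mat_adjoint ?V * ?V = 1\<^sub>m ?N"
    using variational_unitary[of n L "pair_angles L"] jk by (auto simp: unitary_mat_def)
  have F: "?F \<in> carrier_mat ?N ?N"
    using feature_map_unitary[of n a b x] by (auto simp: unitary_mat_def)
  have Z: "Z_on n k \<in> carrier_mat ?N ?N"
    unfolding Z_on_def by (rule tensor_carrier) auto
  have T: "?T \<in> carrier_mat ?N ?N" by (intro two_site_carrier[OF r] gates_carrier)
  note adj = mat_adjoint_carrier[OF V(1)] mat_adjoint_carrier[OF F]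
  note assoc = assoc_mult_mat[of _ ?N ?N _ ?N _ ?N]
  have "mat_adjoint (?V * ?F) * Z_on n k * (?V * ?F) = mat_adjoint ?F * (mat_adjoint ?V * (Z_on n k * ?V * ?F))"
    using V(1) F Z adj by (simp add: mat_adjoint_mult[OF V(1) F] assoc)
  also have "Z_on n k * ?V * ?F = ?V * (?T * ?F)"
    using V(1) F T by (simp add: variational_intertwine[OF assms] assoc)
  also have "mat_adjoint ?V * (?V * (?T * ?F)) = mat_adjoint ?V * ?V * (?T * ?F)"
    using V(1) F T adj by (simp add: assoc)
  also have "\<dots> = ?T * ?F" unfolding V(2) using T F by simp
  also have "mat_adjoint ?F * (?T * ?F) = tensor n (\<lambda>i. mat_adjoint (Ry (?z i)) * (P i * Ry (?z i)))"
  proof -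
    have "mat_adjoint ?F = tensor n (\<lambda>i. mat_adjoint (Ry (?z i)))"
      unfolding feature_map_def by (rule tensor_adjoint) simp
    moreover have "?T * ?F = tensor n (\<lambda>i. P i * Ry (?z i))"
      unfolding feature_map_def two_site_def P_def[symmetric] by (rule tensor_mult) (simp_all add: P)
    ultimately show ?thesis by (simp add: tensor_mult P mat_adjoint_carrier[OF gates_carrier(6)])
  qed
  finally have M: "mat_adjoint (?V * ?F) * Z_on n k * (?V * ?F)
      = tensor n (\<lambda>i. mat_adjoint (Ry (?z i)) * (P i * Ry (?z i)))" (is "_ = tensor n ?Q") .
  have Q: "?Q i \<in> carrier_mat 2 2" for i
    by (simp add: P mat_adjoint_carrier[OF gates_carrier(6)])
  have car: "tensor n ?Q \<in> carrier_mat ?N ?N" using Q by (rule tensor_carrier)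
  have "expectation_Z n L a b (pair_angles L) k x = tensor n ?Q $$ (0, 0)"
  proof -
    have "conjugate (unit_vec ?N 0 :: complex vec) = unit_vec ?N 0"
      by (intro eq_vecI) auto
    then show ?thesis
      unfolding expectation_Z_def Let_def M ket0_def using car by auto
  qed
  also have "\<dots> = (\<Prod>i = 1..n. ?Q i $$ (0, 0))"
    using Q by (rule tensor_00)
  also have "\<dots> = (\<Prod>i = 1..n. complex_of_real (if i = j then sin (?z j) else if i = k then cos (?z k) else 1))"
  proof (rule prod.cong[OF refl])
    fix i
    have Q00: "mat_adjoint (Ry t) * (pauli_X * Ry t) = m22 (complex_of_real (sin t)) (complex_of_real (cos t))
          (complex_of_real (cos t)) (- complex_of_real (sin t))"
      "mat_adjoint (Ry t) * (pauli_Z * Ry t) = m22 (complex_of_real (cos t)) (- complex_of_real (sin t))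
          (- complex_of_real (sin t)) (- complex_of_real (cos t))" for t
    proof -
      have "cos t = (cos (t / 2))\<^sup>2 - (sin (t / 2))\<^sup>2" "sin t = 2 * sin (t / 2) * cos (t / 2)"
        using cos_double[of "t / 2"] sin_double[of "t / 2"] by simp_all
      then have "complex_of_real (cos t) = (complex_of_real (cos (t / 2)))\<^sup>2 - (complex_of_real (sin (t / 2)))\<^sup>2"
        "complex_of_real (sin t) = 2 * complex_of_real (sin (t / 2)) * complex_of_real (cos (t / 2))"
        by simp_all
      then show "mat_adjoint (Ry t) * (pauli_X * Ry t) = m22 (complex_of_real (sin t)) (complex_of_real (cos t))
          (complex_of_real (cos t)) (- complex_of_real (sin t))"
        "mat_adjoint (Ry t) * (pauli_Z * Ry t) = m22 (complex_of_real (cos t)) (- complex_of_real (sin t))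
          (- complex_of_real (sin t)) (- complex_of_real (cos t))"
        unfolding Ry_def pauli_X_def pauli_Z_def m22_adjoint m22_mult
        by (auto intro!: m22_cong simp: power2_eq_square)
    qed
    have "mat_adjoint (Ry t) * (1\<^sub>m 2 * Ry t) = 1\<^sub>m 2" for t
      using Ry_unitary[of t] by (simp add: unitary_mat_def left_mult_one_mat[of _ 2 2])
    then show "?Q i $$ (0, 0) = complex_of_real (if i = j then sin (?z j) else if i = k then cos (?z k) else 1)"
      using Q00 by (simp add: P_def)
  qed
  also have "\<dots> = complex_of_real (\<Prod>i = 1..n. (if i = j then sin (?z j) else 1) * (if i = k then cos (?z k) else 1))"
    unfolding of_real_prod by (rule prod.cong) (use r in auto)
  also have "(\<Prod>i = 1..n. (if i = j then sin (?z j) else 1) * (if i = k then cos (?z k) else 1)) = sin (?z j) * cos (?z k)"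
    using r unfolding prod.distrib by (subst (1 2) prod.delta) auto
  finally show ?thesis .
qed

end

text \<open>Measuring the odd qubits 3, 5, ... with the angle of their partners fixed at \<open>pi / 2\<close> gives one free
  cosine for each pair. The remaining outputs get weight 0.\<close>

lemma qnn_realizes_cosine_sum:
  fixes w :: "nat \<Rightarrow> real ^ 'd" and \<beta> c :: "nat \<Rightarrow> real"
  assumes "L \<ge> 1" "2 * m < n"
  shows "\<exists>a b \<Gamma> c'. \<forall>x. qnn_output n L a b \<Gamma> c' 0 x = complex_of_real (\<Sum>p = 1..m. c p * cos (inner (w p) x + \<beta> p))"
proof -
  \<comment> \<open>The pair number p consists of the qubits 2 p and 2 p + 1.\<close>
  define a where "a i = (if odd i then w (i div 2) else 0)" for i
  define b where "b i = (if odd i then \<beta> (i div 2) else pi / 2)" for i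
  define c' where "c' i = (if i \<in> (\<lambda>p. 2 * p + 1) ` {1..m} then c (i div 2) else 0)" for i
  have "qnn_output n L a b (pair_angles L) c' 0 x = complex_of_real (\<Sum>p = 1..m. c p * cos (inner (w p) x + \<beta> p))" for x
  proof -
    have "qnn_output n L a b (pair_angles L) c' 0 x
        = (\<Sum>i = 1..n. complex_of_real (c' i) * expectation_Z n L a b (pair_angles L) i x)"
      by (simp add: qnn_output_def)
    also have "\<dots> = (\<Sum>i\<in>(\<lambda>p. 2 * p + 1) ` {1..m}. complex_of_real (c' i) * expectation_Z n L a b (pair_angles L) i x)"
      using assms by (intro sum.mono_neutral_right) (auto simp: c'_def)
    also have "\<dots> = (\<Sum>p = 1..m. complex_of_real (c p) * expectation_Z n L a b (pair_angles L) (2 * p + 1) x)"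
      by (subst sum.reindex) (auto simp: inj_on_def c'_def intro!: sum.cong)
    also have "\<dots> = (\<Sum>p = 1..m. complex_of_real (c p * cos (inner (w p) x + \<beta> p)))"
    proof (rule sum.cong[OF refl])
      fix p assume "p \<in> {1..m}"
      then have "expectation_Z n L a b (pair_angles L) (2 * p + 1) x
          = complex_of_real (sin (inner (a (2 * p)) x + b (2 * p)) * cos (inner (a (2 * p + 1)) x + b (2 * p + 1)))"
        using assms by (intro expectation_Z_eq) auto
      then show "complex_of_real (c p) * expectation_Z n L a b (pair_angles L) (2 * p + 1) x
          = complex_of_real (c p * cos (inner (w p) x + \<beta> p))"
        by (simp add: a_def b_def)
    qed
    finally show ?thesis by simp
  qed
  then show ?thesis by blast
qed

section \<open>Gaussians on Euclidean spaces\<close>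

lemma lborel_affine_integrable:
  fixes f :: "'a :: euclidean_space \<Rightarrow> 'b :: {banach, second_countable_topology}"
  assumes c: "c \<noteq> 0" and f: "integrable lborel f"
  shows "integrable lborel (\<lambda>x. f (t + c *\<^sub>R x))"
proof -
  have [measurable]: "f \<in> borel_measurable borel" using f by auto
  have "integrable (density (distr lborel borel (\<lambda>x. t + c *\<^sub>R x)) (\<lambda>_. ennreal (\<bar>c\<bar> ^ DIM('a)))) f"
    using f lborel_affine[OF c, of t] by (simp add: ennreal_power)
  then have "integrable lborel (\<lambda>x. \<bar>c\<bar> ^ DIM('a) *\<^sub>R f (t + c *\<^sub>R x))"
    by (subst (asm) integrable_density) (auto simp: integrable_distr_eq)
  then have "integrable lborel (\<lambda>x. inverse (\<bar>c\<bar> ^ DIM('a)) *\<^sub>R \<bar>c\<bar> ^ DIM('a) *\<^sub>R f (t + c *\<^sub>R x))"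
    by (rule integrable_scaleR_right)
  then show ?thesis using c by simp
qed

lemma lborel_affine_integral:
  fixes f :: "'a :: euclidean_space \<Rightarrow> 'b :: {banach, second_countable_topology}"
  assumes c: "c \<noteq> 0" and [measurable]: "f \<in> borel_measurable borel"
  shows "integral\<^sup>L lborel f = \<bar>c\<bar> ^ DIM('a) *\<^sub>R (\<integral>x. f (t + c *\<^sub>R x) \<partial>lborel)"
proof -
  have "integral\<^sup>L lborel f
      = integral\<^sup>L (density (distr lborel borel (\<lambda>x. t + c *\<^sub>R x)) (\<lambda>_. ennreal (\<bar>c\<bar> ^ DIM('a)))) f"
    using lborel_affine[OF c, of t] by (simp add: ennreal_power)
  then show ?thesis
    by (subst (asm) integral_density) (auto simp: integral_distr)
qed

text \<open>Lebesgue measure on a Euclidean space is the image of a product of one-dimensional ones, so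
  Gaussian integrals reduce to dimension one.\<close>

lemma lborel_integral_Basis_prod:
  fixes g :: "'a :: euclidean_space \<Rightarrow> real \<Rightarrow> 'b :: {real_normed_field, banach, second_countable_topology}"
  assumes g: "\<And>b. b \<in> Basis \<Longrightarrow> integrable lborel (g b)"
  shows "integrable lborel (\<lambda>x :: 'a. \<Prod>b\<in>Basis. g b (inner x b))"
    and "(\<integral>x. (\<Prod>b\<in>Basis. g b (inner (x :: 'a) b)) \<partial>lborel) = (\<Prod>b\<in>Basis. integral\<^sup>L lborel (g b))"
proof -
  interpret product_sigma_finite "\<lambda>_ :: 'a. lborel :: real measure" ..
  have [measurable]: "b \<in> Basis \<Longrightarrow> g b \<in> borel_measurable borel" for b
    using g[of b] by auto
  let ?P = "Pi\<^sub>M Basis (\<lambda>_ :: 'a. lborel :: real measure)"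
  have m: "(\<lambda>f. \<Sum>b\<in>Basis. f b *\<^sub>R b) \<in> measurable ?P (borel :: 'a measure)"
    by measurable
  have gm: "(\<lambda>x :: 'a. \<Prod>b\<in>Basis. g b (inner x b)) \<in> borel_measurable borel"
    by measurable
  have *: "(\<Prod>b\<in>Basis. g b (inner (\<Sum>b'\<in>Basis. f b' *\<^sub>R b') b)) = (\<Prod>b\<in>Basis. g b (f b))" for f :: "'a \<Rightarrow> real"
    by (intro prod.cong) (auto simp: inner_sum_left_Basis)
  show "integrable lborel (\<lambda>x :: 'a. \<Prod>b\<in>Basis. g b (inner x b))"
    unfolding lborel_eq[where 'a = 'a] integrable_distr_eq[OF m gm] *
    by (rule product_integrable_prod) (auto simp: g)
  show "(\<integral>x. (\<Prod>b\<in>Basis. g b (inner (x :: 'a) b)) \<partial>lborel) = (\<Prod>b\<in>Basis. integral\<^sup>L lborel (g b))"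
    unfolding lborel_eq[where 'a = 'a] integral_distr[OF m gm] *
    by (rule product_integral_prod) (auto simp: g)
qed

definition gauss :: "'a :: euclidean_space \<Rightarrow> real" where
  "gauss x = (\<Prod>b\<in>Basis. std_normal_density (inner x b))"

lemma exp_norm_prod: "exp (- (norm x)\<^sup>2 / 2) = (\<Prod>b\<in>Basis. exp (- (inner x b)\<^sup>2 / 2))"
  for x :: "'a :: euclidean_space"
proof -
  have "(norm x)\<^sup>2 = (\<Sum>b\<in>Basis. (inner x b)\<^sup>2)"
    unfolding power2_norm_eq_inner by (subst euclidean_inner) (simp add: power2_eq_square)
  then show ?thesis by (simp add: exp_sum sum_negf sum_divide_distrib flip: exp_sum)
qed

lemma gauss_eq: "gauss x = exp (- (norm x)\<^sup>2 / 2) / sqrt (2 * pi) ^ DIM('a)"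
  for x :: "'a :: euclidean_space"
  unfolding gauss_def exp_norm_prod std_normal_density_def by (simp add: prod_dividef)

lemma gauss_nonneg: "gauss x \<ge> 0"
  by (simp add: gauss_eq)

lemma gauss_le_exp: "gauss x \<le> exp (- (norm x)\<^sup>2 / 2)"
  for x :: "'a :: euclidean_space"
proof -
  have "1 \<le> sqrt (2 * pi) ^ DIM('a)"
    using pi_gt3 by (intro one_le_power) (simp add: real_le_rsqrt)
  then have "exp (- (norm x)\<^sup>2 / 2) / sqrt (2 * pi) ^ DIM('a) \<le> exp (- (norm x)\<^sup>2 / 2) / 1"
    by (intro divide_left_mono) auto
  then show ?thesis by (simp add: gauss_eq)
qed

lemma gauss_le_1: "gauss x \<le> 1"
  by (rule order_trans[OF gauss_le_exp]) simp

lemma gauss_measurable [measurable]: "gauss \<in> borel_measurable borel"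
  unfolding gauss_eq[abs_def] by measurable

lemma gauss_integrable: "integrable lborel gauss"
  unfolding gauss_def[abs_def] by (rule lborel_integral_Basis_prod) simp

lemma gauss_integral: "integral\<^sup>L lborel (gauss :: 'a :: euclidean_space \<Rightarrow> real) = 1"
  unfolding gauss_def[abs_def] by (subst lborel_integral_Basis_prod) simp_all

lemma fourier_std_normal:
  "(\<integral>x. complex_of_real (std_normal_density x) * exp (\<i> * complex_of_real (x * t)) \<partial>lborel)
    = complex_of_real (exp (- t\<^sup>2 / 2))"
proof -
  have "char std_normal_distribution t = (\<integral>x. std_normal_density x *\<^sub>R iexp (t * x) \<partial>lborel)"
    unfolding char_def by (subst integral_density) auto
  then show ?thesis
    unfolding char_std_normal_distribution by (simp add: scaleR_conv_of_real mult_ac)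
qed

text \<open>Up to normalisation the Gaussian is its own Fourier transform.\<close>

lemma fourier_gauss:
  fixes y :: "'a :: euclidean_space"
  shows "(\<integral>x. complex_of_real (gauss x) * exp (\<i> * complex_of_real (inner x y)) \<partial>lborel)
    = complex_of_real (sqrt (2 * pi) ^ DIM('a) * gauss y)"
proof -
  have "complex_of_real (gauss x) * exp (\<i> * complex_of_real (inner x y))
      = (\<Prod>b\<in>Basis. complex_of_real (std_normal_density (inner x b)) * exp (\<i> * complex_of_real (inner x b * inner y b)))"
    for x :: 'a
    unfolding gauss_def prod.distrib
    by (simp add: euclidean_inner[of x y] sum_distrib_left flip: exp_sum)
  moreover have "(\<integral>x. (\<Prod>b\<in>Basis. complex_of_real (std_normal_density (inner x b)) * exp (\<i> * complex_of_real (inner x b * inner y b))) \<partial>lborel)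
      = (\<Prod>b\<in>Basis. \<integral>x. complex_of_real (std_normal_density x) * exp (\<i> * complex_of_real (x * inner y b)) \<partial>lborel)"
  proof (rule lborel_integral_Basis_prod(2)[of "\<lambda>b x. complex_of_real (std_normal_density x) * exp (\<i> * complex_of_real (x * inner y b))"])
    fix b :: 'a
    have "integrable lborel std_normal_density" by simp
    then show "integrable lborel (\<lambda>x. complex_of_real (std_normal_density x) * exp (\<i> * complex_of_real (x * inner y b)))"
      by (rule Bochner_Integration.integrable_bound) (auto simp: norm_mult)
  qed
  ultimately have "(\<integral>x. complex_of_real (gauss x) * exp (\<i> * complex_of_real (inner x y)) \<partial>lborel)
      = (\<Prod>b\<in>Basis. complex_of_real (exp (- (inner y b)\<^sup>2 / 2)))"
    by (simp only: fourier_std_normal)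
  also have "\<dots> = complex_of_real (exp (- (norm y)\<^sup>2 / 2))"
    unfolding exp_norm_prod by (rule of_real_prod[symmetric])
  finally show ?thesis by (simp add: gauss_eq)
qed


section \<open>Gaussian approximate identities\<close>

text \<open>Away from the origin the rescaled Gaussians tend to 0 uniformly, so integrability of f suffices there.\<close>

lemma approximate_identity_far:
  fixes f :: "'a :: euclidean_space \<Rightarrow> real"
  assumes f: "integrable lborel f" and d: "\<delta> > 0"
  shows "(\<lambda>n. \<integral>u. f (x + u) * indicat_real (- ball 0 \<delta>) u * (real (Suc n) ^ DIM('a) * gauss (real (Suc n) *\<^sub>R u)) \<partial>lborel) \<longlonglongrightarrow> 0"
proof -
  let ?D = "DIM('a)"
  have [measurable]: "f \<in> borel_measurable borel" using f by auto
  \<comment> \<open>Outside the ball, \<open>q m\<close> bounds the rescaled Gaussian uniformly.\<close>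
  define q where "q m = m ^ ?D * exp (- (m\<^sup>2 * \<delta>\<^sup>2) / 2)" for m :: real
  have q0: "(\<lambda>n. q (real (Suc n))) \<longlonglongrightarrow> 0"
  proof -
    have "((\<lambda>m. q m) \<longlongrightarrow> 0) at_top"
      unfolding q_def using d by real_asymp
    then show ?thesis
      by (rule filterlim_compose) real_asymp
  qed
  then obtain K where K: "norm (q (real (Suc n))) \<le> K" for n
    using convergent_imp_Bseq[of "\<lambda>n. q (real (Suc n))"] by (auto simp: convergent_def Bseq_def)
  have g: "real (Suc n) ^ ?D * gauss (real (Suc n) *\<^sub>R u) \<le> q (real (Suc n))" if "u \<notin> ball 0 \<delta>" for n and u :: 'a
  proof -
    have "\<delta> \<le> norm u" using that by simp
    then have "\<delta>\<^sup>2 \<le> (norm u)\<^sup>2" using d by (intro power_mono) auto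
    then have "exp (- (norm (real (Suc n) *\<^sub>R u))\<^sup>2 / 2) \<le> exp (- ((real (Suc n))\<^sup>2 * \<delta>\<^sup>2) / 2)"
      by (simp add: power_mult_distrib)
    with gauss_le_exp have "gauss (real (Suc n) *\<^sub>R u) \<le> exp (- ((real (Suc n))\<^sup>2 * \<delta>\<^sup>2) / 2)"
      by (rule order_trans)
    then show ?thesis unfolding q_def by (intro mult_left_mono) auto
  qed
  have b: "norm (f (x + u) * indicat_real (- ball 0 \<delta>) u * (real (Suc n) ^ ?D * gauss (real (Suc n) *\<^sub>R u)))
      \<le> norm (f (x + u)) * q (real (Suc n))" for n u
    using g[of u n] gauss_nonneg[of "real (Suc n) *\<^sub>R u"]
    by (auto simp: abs_mult indicator_def q_def intro!: mult_left_mono)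
  have int: "integrable lborel (\<lambda>u. f (x + u))"
    using lborel_affine_integrable[of 1 f x] f by simp
  have "(\<lambda>n. \<integral>u. f (x + u) * indicat_real (- ball 0 \<delta>) u * (real (Suc n) ^ ?D * gauss (real (Suc n) *\<^sub>R u)) \<partial>lborel)
      \<longlonglongrightarrow> integral\<^sup>L lborel (\<lambda>u :: 'a. 0 :: real)"
  proof (rule integral_dominated_convergence[where w = "\<lambda>u. norm (f (x + u)) * K"])
    show "integrable lborel (\<lambda>u. norm (f (x + u)) * K)"
      using int by simp
    show "AE u in lborel. (\<lambda>n. f (x + u) * indicat_real (- ball 0 \<delta>) u * (real (Suc n) ^ ?D * gauss (real (Suc n) *\<^sub>R u))) \<longlonglongrightarrow> 0"
    proof (intro AE_I2 Lim_null_comparison[OF always_eventually[OF allI[OF b]]])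
      fix u
      show "(\<lambda>n. norm (f (x + u)) * q (real (Suc n))) \<longlonglongrightarrow> 0"
        by (rule tendsto_mult_right_zero[OF q0])
    qed
    show "AE u in lborel. norm (f (x + u) * indicat_real (- ball 0 \<delta>) u * (real (Suc n) ^ ?D * gauss (real (Suc n) *\<^sub>R u))) \<le> norm (f (x + u)) * K" for n
    proof (rule AE_I2)
      fix u
      have "norm (f (x + u)) * q (real (Suc n)) \<le> norm (f (x + u)) * K"
        using K[of n] by (intro mult_left_mono) auto
      with b[of u n] show "norm (f (x + u) * indicat_real (- ball 0 \<delta>) u * (real (Suc n) ^ ?D * gauss (real (Suc n) *\<^sub>R u))) \<le> norm (f (x + u)) * K"
        by linarith
    qed
  qed measurable
  then show ?thesis by simp
qed

text \<open>Near x the function is bounded. After the rescaling v = m u the integrands converge pointwise and are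
  dominated by a multiple of the Gaussian.\<close>

lemma approximate_identity_near:
  fixes f :: "'a :: euclidean_space \<Rightarrow> real"
  assumes f: "f \<in> borel_measurable borel" and cont: "isCont f x"
    and d: "\<delta> > 0" and M: "\<And>y. norm (y - x) < \<delta> \<Longrightarrow> \<bar>f y\<bar> \<le> M"
  shows "(\<lambda>n. \<integral>u. f (x + u) * indicat_real (ball 0 \<delta>) u * (real (Suc n) ^ DIM('a) * gauss (real (Suc n) *\<^sub>R u)) \<partial>lborel) \<longlonglongrightarrow> f x"
proof -
  let ?D = "DIM('a)"
  note [measurable] = f
  have [measurable]: "(\<lambda>v :: 'a. indicat_real (ball 0 \<delta>) (v /\<^sub>R real (Suc n))) \<in> borel_measurable borel" for n
    by (rule measurable_compose[where N = borel and g = "indicat_real (ball 0 \<delta>)"])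
      (auto intro: borel_measurable_indicator)
  have eq: "(\<integral>u. f (x + u) * indicat_real (ball 0 \<delta>) u * (real (Suc n) ^ ?D * gauss (real (Suc n) *\<^sub>R u)) \<partial>lborel)
      = (\<integral>v. f (x + v /\<^sub>R real (Suc n)) * indicat_real (ball 0 \<delta>) (v /\<^sub>R real (Suc n)) * gauss v \<partial>lborel)" for n
  proof -
    have "(\<integral>v. f (x + v /\<^sub>R real (Suc n)) * indicat_real (ball 0 \<delta>) (v /\<^sub>R real (Suc n)) * gauss v \<partial>lborel)
      = real (Suc n) ^ ?D * (\<integral>u. f (x + u) * indicat_real (ball 0 \<delta>) u * gauss (real (Suc n) *\<^sub>R u) \<partial>lborel)"
    proof (subst lborel_affine_integral[of "real (Suc n)" _ 0])
      show "(\<lambda>v. f (x + v /\<^sub>R real (Suc n)) * indicat_real (ball 0 \<delta>) (v /\<^sub>R real (Suc n)) * gauss v) \<in> borel_measurable borel"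
        by measurable
    qed (simp_all del: of_nat_Suc)
    also have "\<dots> = (\<integral>u. real (Suc n) ^ ?D * (f (x + u) * indicat_real (ball 0 \<delta>) u * gauss (real (Suc n) *\<^sub>R u)) \<partial>lborel)"
      by simp
    finally show ?thesis by (simp only: mult_ac)
  qed
  have "(\<lambda>n. \<integral>v. f (x + v /\<^sub>R real (Suc n)) * indicat_real (ball 0 \<delta>) (v /\<^sub>R real (Suc n)) * gauss v \<partial>lborel)
      \<longlonglongrightarrow> integral\<^sup>L lborel (\<lambda>v :: 'a. f x * gauss v)"
  proof (rule integral_dominated_convergence[where w = "\<lambda>v :: 'a. M * gauss v"])
    show "integrable lborel (\<lambda>v :: 'a. M * gauss v)" by (simp add: gauss_integrable)
    show "AE v in lborel. (\<lambda>n. f (x + v /\<^sub>R real (Suc n)) * indicat_real (ball 0 \<delta>) (v /\<^sub>R real (Suc n)) * gauss v) \<longlonglongrightarrow> f x * gauss v"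
    proof (rule AE_I2)
      fix v :: 'a
      have v0: "(\<lambda>n. v /\<^sub>R real (Suc n)) \<longlonglongrightarrow> 0"
        using tendsto_scaleR[OF LIMSEQ_inverse_real_of_nat tendsto_const[of v]] by simp
      then have "(\<lambda>n. x + v /\<^sub>R real (Suc n)) \<longlonglongrightarrow> x"
        using tendsto_add[OF tendsto_const[of x] v0] by simp
      then have 1: "(\<lambda>n. f (x + v /\<^sub>R real (Suc n))) \<longlonglongrightarrow> f x"
        by (rule isCont_tendsto_compose[OF cont])
      have "\<forall>\<^sub>F n in sequentially. v /\<^sub>R real (Suc n) \<in> ball 0 \<delta>"
        by (rule topological_tendstoD[OF v0]) (use d in auto)
      then have "\<forall>\<^sub>F n in sequentially. indicat_real (ball 0 \<delta>) (v /\<^sub>R real (Suc n)) = 1"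
        by eventually_elim (simp add: indicator_def)
      then have 2: "(\<lambda>n. indicat_real (ball 0 \<delta>) (v /\<^sub>R real (Suc n))) \<longlonglongrightarrow> 1"
        by (rule tendsto_eventually)
      show "(\<lambda>n. f (x + v /\<^sub>R real (Suc n)) * indicat_real (ball 0 \<delta>) (v /\<^sub>R real (Suc n)) * gauss v) \<longlonglongrightarrow> f x * gauss v"
        using tendsto_mult[OF tendsto_mult[OF 1 2] tendsto_const[of "gauss v"]] by simp
    qed
    have "\<bar>f x\<bar> \<le> M" using M[of x] d by simp
    then have M0: "0 \<le> M" by linarith
    show "AE v in lborel. norm (f (x + v /\<^sub>R real (Suc n)) * indicat_real (ball 0 \<delta>) (v /\<^sub>R real (Suc n)) * gauss v) \<le> M * gauss v" for n
    proof (rule AE_I2)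
      fix v :: 'a
      have "norm (f (x + v /\<^sub>R real (Suc n)) * indicat_real (ball 0 \<delta>) (v /\<^sub>R real (Suc n))) \<le> M"
        using M[of "x + v /\<^sub>R real (Suc n)"] M0 by (auto simp: indicator_def)
      then show "norm (f (x + v /\<^sub>R real (Suc n)) * indicat_real (ball 0 \<delta>) (v /\<^sub>R real (Suc n)) * gauss v) \<le> M * gauss v"
        using gauss_nonneg[of v] by (simp only: norm_mult[of _ "gauss v"]) (simp add: mult_right_mono)
    qed
  qed measurable
  then show ?thesis unfolding eq by (simp add: gauss_integral)
qed

text \<open>The function need not be bounded on the whole space, hence the separate treatment of a ball on which
  it is bounded by continuity, and of its complement.\<close>

lemma approximate_identity:
  fixes f :: "'a :: euclidean_space \<Rightarrow> real"
  assumes f: "integrable lborel f" and cont: "isCont f x"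
  shows "(\<lambda>n. \<integral>u. f (x + u) * (real (Suc n) ^ DIM('a) * gauss (real (Suc n) *\<^sub>R u)) \<partial>lborel) \<longlonglongrightarrow> f x"
proof -
  let ?D = "DIM('a)"
  have [measurable]: "f \<in> borel_measurable borel" using f by auto
  have "f \<midarrow>x\<rightarrow> f x" using cont by (rule isContD)
  from this[unfolded LIM_eq, rule_format, of 1] obtain \<delta> where d: "\<delta> > 0"
    and \<delta>: "\<forall>y. y \<noteq> x \<and> norm (y - x) < \<delta> \<longrightarrow> norm (f y - f x) < 1"
    by auto
  have M: "\<bar>f y\<bar> \<le> \<bar>f x\<bar> + 1" if "norm (y - x) < \<delta>" for y
  proof (cases "y = x")
    case False
    then have "\<bar>f y - f x\<bar> < 1" using \<delta> that by simp
    then show ?thesis by linarith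
  qed simp
  let ?k = "\<lambda>n u. real (Suc n) ^ ?D * gauss (real (Suc n) *\<^sub>R u :: 'a)"
  have "integrable lborel (\<lambda>u. f (x + u) * indicat_real A u * ?k n u)" if [measurable]: "A \<in> sets borel" for A n
  proof (rule Bochner_Integration.integrable_bound)
    have "integrable lborel (\<lambda>u. f (x + u))"
      using lborel_affine_integrable[of 1 f x] f by simp
    then show "integrable lborel (\<lambda>u. f (x + u) * real (Suc n) ^ ?D)" by simp
    show "AE u in lborel. norm (f (x + u) * indicat_real A u * ?k n u) \<le> norm (f (x + u) * real (Suc n) ^ ?D)"
      by (intro AE_I2) (auto simp: abs_mult indicator_def mult_left_le gauss_le_1 abs_of_nonneg[OF gauss_nonneg]
          intro!: mult_left_mono)
  qed measurable
  note int = this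
  have "(\<integral>u. f (x + u) * ?k n u \<partial>lborel) = (\<integral>u. f (x + u) * indicat_real (ball 0 \<delta>) u * ?k n u \<partial>lborel)
      + (\<integral>u. f (x + u) * indicat_real (- ball 0 \<delta>) u * ?k n u \<partial>lborel)" for n
  proof -
    have "(\<integral>u. f (x + u) * ?k n u \<partial>lborel) = (\<integral>u. f (x + u) * indicat_real (ball 0 \<delta>) u * ?k n u
        + f (x + u) * indicat_real (- ball 0 \<delta>) u * ?k n u \<partial>lborel)"
      by (rule Bochner_Integration.integral_cong) (auto simp: indicator_def)
    also have "\<dots> = (\<integral>u. f (x + u) * indicat_real (ball 0 \<delta>) u * ?k n u \<partial>lborel)
        + (\<integral>u. f (x + u) * indicat_real (- ball 0 \<delta>) u * ?k n u \<partial>lborel)"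
      by (rule Bochner_Integration.integral_add[OF int int]) auto
    finally show ?thesis .
  qed
  then show ?thesis
    using tendsto_add[OF approximate_identity_near[OF _ cont d M] approximate_identity_far[OF f d, of x]] by simp
qed


section \<open>Fourier inversion\<close>

lemma gauss_minus: "gauss (- x) = gauss x"
  by (simp add: gauss_eq)

lemma isCont_gauss: "isCont gauss x"
  unfolding gauss_eq[abs_def] by (intro continuous_intros) auto

lemma fourier_scaled_gauss:
  fixes y :: "'a :: euclidean_space"
  assumes "m > 0"
  shows "(\<integral>\<xi>. complex_of_real (gauss (\<xi> /\<^sub>R m)) * exp (\<i> * complex_of_real (inner \<xi> y)) \<partial>lborel)
    = complex_of_real (sqrt (2 * pi) ^ DIM('a) * (m ^ DIM('a) * gauss (m *\<^sub>R y)))"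
proof -
  have "(\<integral>\<xi>. complex_of_real (gauss (\<xi> /\<^sub>R m)) * exp (\<i> * complex_of_real (inner \<xi> y)) \<partial>lborel)
      = m ^ DIM('a) *\<^sub>R (\<integral>\<eta>. complex_of_real (gauss \<eta>) * exp (\<i> * complex_of_real (inner \<eta> (m *\<^sub>R y))) \<partial>lborel)"
    using assms by (subst lborel_affine_integral[of m _ 0]) auto
  then show ?thesis
    unfolding fourier_gauss by (simp add: scaleR_conv_of_real)
qed

text \<open>The factor \<open>gauss (\<xi> /\<^sub>R m)\<close> makes the double integral over \<open>\<xi>\<close> and y absolutely convergent, so that the
  order of integration may be exchanged. The inner integral over \<open>\<xi>\<close> is then a Fourier transform of a
  Gaussian, and what remains is the convolution of f with an approximate identity.\<close>

lemma gaussian_regularized_inversion: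
  fixes f :: "real ^ 'd \<Rightarrow> real"
  assumes f: "integrable lborel f" and F: "integrable lborel (fourier f)" and m: "m > 0"
  shows "(\<integral>\<xi>. complex_of_real (gauss (\<xi> /\<^sub>R m)) * (fourier f \<xi> * exp (\<i> * complex_of_real (inner \<xi> x))) \<partial>lborel)
    = complex_of_real (sqrt (2 * pi) ^ DIM(real ^ 'd) *
        (\<integral>u. f (x + u) * (m ^ DIM(real ^ 'd) * gauss (m *\<^sub>R u)) \<partial>lborel))"
proof -
  let ?D = "DIM(real ^ 'd)"
  have [measurable]: "f \<in> borel_measurable borel" using f by auto
  define H where "H \<xi> y = complex_of_real (gauss (\<xi> /\<^sub>R m)) * (complex_of_real (f y) * exp (\<i> * complex_of_real (inner \<xi> (x - y))))"
    for \<xi> y :: "real ^ 'd"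
  have g: "integrable lborel (\<lambda>\<xi> :: real ^ 'd. gauss (\<xi> /\<^sub>R m))"
    using lborel_affine_integrable[of "inverse m" gauss 0] m gauss_integrable by simp
  have H_norm: "norm (H \<xi> y) = gauss (\<xi> /\<^sub>R m) * \<bar>f y\<bar>" for \<xi> y
    using gauss_nonneg[of "\<xi> /\<^sub>R m"] by (simp add: H_def norm_mult)
  have H_meas: "case_prod H \<in> borel_measurable (lborel \<Otimes>\<^sub>M lborel)"
    unfolding H_def[abs_def] by measurable
  have H_int: "integrable (lborel \<Otimes>\<^sub>M lborel) (case_prod H)"
  proof (rule lborel_pair.Fubini_integrable[OF H_meas])
    show "integrable lborel (\<lambda>\<xi>. \<integral>y. norm (case (\<xi>, y) of (\<xi>, y) \<Rightarrow> H \<xi> y) \<partial>lborel)"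
      using g by (simp add: H_norm)
    have "integrable lborel (H \<xi>)" for \<xi>
      unfolding H_def[abs_def]
      by (intro integrable_mult_right Bochner_Integration.integrable_bound[OF f]) (auto simp: norm_mult)
    then show "AE \<xi> in lborel. integrable lborel (\<lambda>y. case (\<xi>, y) of (\<xi>, y) \<Rightarrow> H \<xi> y)"
      by simp
  qed
  have "(\<integral>\<xi>. complex_of_real (gauss (\<xi> /\<^sub>R m)) * (fourier f \<xi> * exp (\<i> * complex_of_real (inner \<xi> x))) \<partial>lborel)
      = (\<integral>\<xi>. (\<integral>y. H \<xi> y \<partial>lborel) \<partial>lborel)"
  proof (rule Bochner_Integration.integral_cong[OF refl])
    fix \<xi> :: "real ^ 'd"
    have "fourier f \<xi> * exp (\<i> * complex_of_real (inner \<xi> x))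
        = (\<integral>y. complex_of_real (f y) * exp (- (\<i> * complex_of_real (inner \<xi> y))) * exp (\<i> * complex_of_real (inner \<xi> x)) \<partial>lborel)"
      unfolding fourier_def by simp
    also have "\<dots> = (\<integral>y. complex_of_real (f y) * exp (\<i> * complex_of_real (inner \<xi> (x - y))) \<partial>lborel)"
      by (intro Bochner_Integration.integral_cong) (auto simp: inner_diff_right algebra_simps simp flip: exp_add)
    finally show "complex_of_real (gauss (\<xi> /\<^sub>R m)) * (fourier f \<xi> * exp (\<i> * complex_of_real (inner \<xi> x))) = (\<integral>y. H \<xi> y \<partial>lborel)"
      by (simp add: H_def)
  qed
  also have "\<dots> = (\<integral>y. (\<integral>\<xi>. H \<xi> y \<partial>lborel) \<partial>lborel)"
    by (rule lborel_pair.Fubini_integral[OF H_int, symmetric])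
  also have "\<dots> = (\<integral>y. complex_of_real (sqrt (2 * pi) ^ ?D * (f y * (m ^ ?D * gauss (m *\<^sub>R (y - x))))) \<partial>lborel)"
  proof (rule Bochner_Integration.integral_cong[OF refl])
    fix y :: "real ^ 'd"
    have "(\<integral>\<xi>. H \<xi> y \<partial>lborel) = (\<integral>\<xi>. complex_of_real (f y) *
        (complex_of_real (gauss (\<xi> /\<^sub>R m)) * exp (\<i> * complex_of_real (inner \<xi> (x - y)))) \<partial>lborel)"
      by (simp add: H_def mult_ac)
    also have "\<dots> = complex_of_real (f y) * complex_of_real (sqrt (2 * pi) ^ ?D * (m ^ ?D * gauss (m *\<^sub>R (x - y))))"
      by (simp only: integral_mult_right_zero fourier_scaled_gauss[OF m])
    also have "gauss (m *\<^sub>R (x - y)) = gauss (m *\<^sub>R (y - x))"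
      using gauss_minus[of "m *\<^sub>R (x - y)"] by (simp flip: scaleR_minus_right)
    finally show "(\<integral>\<xi>. H \<xi> y \<partial>lborel) = complex_of_real (sqrt (2 * pi) ^ ?D * (f y * (m ^ ?D * gauss (m *\<^sub>R (y - x)))))"
      by simp
  qed
  also have "\<dots> = complex_of_real (sqrt (2 * pi) ^ ?D * (\<integral>y. f y * (m ^ ?D * gauss (m *\<^sub>R (y - x))) \<partial>lborel))"
    by (simp only: integral_complex_of_real integral_mult_right_zero)
  also have "(\<integral>y. f y * (m ^ ?D * gauss (m *\<^sub>R (y - x))) \<partial>lborel) = (\<integral>u. f (x + u) * (m ^ ?D * gauss (m *\<^sub>R u)) \<partial>lborel)"
    by (subst lborel_affine_integral[of 1 _ x]) auto
  finally show ?thesis .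
qed

text \<open>Let m tend to infinity in the regularised identity: by dominated convergence the left-hand side tends
  to the inversion integral times \<open>gauss 0\<close>, and the right-hand side tends to a multiple of \<open>f x\<close>.\<close>

lemma fourier_inversion:
  fixes f :: "real ^ 'd \<Rightarrow> real"
  assumes f: "integrable lborel f" and F: "integrable lborel (fourier f)" and cont: "isCont f x"
  shows "(\<integral>\<xi>. fourier f \<xi> * exp (\<i> * complex_of_real (inner \<xi> x)) \<partial>lborel)
    = complex_of_real ((2 * pi) ^ DIM(real ^ 'd) * f x)"
proof -
  let ?D = "DIM(real ^ 'd)"
  let ?e = "\<lambda>\<xi>. fourier f \<xi> * exp (\<i> * complex_of_real (inner \<xi> x))"
  let ?S = "sqrt (2 * pi) ^ ?D"
  have [measurable]: "fourier f \<in> borel_measurable borel" using F by auto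
  have lim: "(\<lambda>n. \<integral>\<xi>. complex_of_real (gauss (\<xi> /\<^sub>R real (Suc n))) * ?e \<xi> \<partial>lborel)
      \<longlonglongrightarrow> (\<integral>\<xi>. complex_of_real (gauss (0 :: real ^ 'd)) * ?e \<xi> \<partial>lborel)"
  proof (rule integral_dominated_convergence[where w = "\<lambda>\<xi>. norm (fourier f \<xi>)"])
    show "AE \<xi> in lborel. (\<lambda>n. complex_of_real (gauss (\<xi> /\<^sub>R real (Suc n))) * ?e \<xi>) \<longlonglongrightarrow> complex_of_real (gauss (0 :: real ^ 'd)) * ?e \<xi>"
    proof (rule AE_I2)
      fix \<xi> :: "real ^ 'd"
      have "(\<lambda>n. \<xi> /\<^sub>R real (Suc n)) \<longlonglongrightarrow> 0"
        using tendsto_scaleR[OF LIMSEQ_inverse_real_of_nat tendsto_const[of \<xi>]] by simp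
      then have "(\<lambda>n. gauss (\<xi> /\<^sub>R real (Suc n))) \<longlonglongrightarrow> gauss (0 :: real ^ 'd)"
        by (rule isCont_tendsto_compose[OF isCont_gauss])
      then show "(\<lambda>n. complex_of_real (gauss (\<xi> /\<^sub>R real (Suc n))) * ?e \<xi>) \<longlonglongrightarrow> complex_of_real (gauss (0 :: real ^ 'd)) * ?e \<xi>"
        by (intro tendsto_mult tendsto_of_real tendsto_const)
    qed
    show "AE \<xi> in lborel. norm (complex_of_real (gauss (\<xi> /\<^sub>R real (Suc n))) * ?e \<xi>) \<le> norm (fourier f \<xi>)" for n
    proof (rule AE_I2)
      fix \<xi> :: "real ^ 'd"
      show "norm (complex_of_real (gauss (\<xi> /\<^sub>R real (Suc n))) * ?e \<xi>) \<le> norm (fourier f \<xi>)"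
        using gauss_nonneg[of "\<xi> /\<^sub>R real (Suc n)"] gauss_le_1[of "\<xi> /\<^sub>R real (Suc n)"]
        by (simp add: norm_mult mult_left_le_one_le del: of_nat_Suc)
    qed
  qed (use F in \<open>simp_all del: of_nat_Suc\<close>)
  have eq: "(\<integral>\<xi>. complex_of_real (gauss (\<xi> /\<^sub>R real (Suc n))) * ?e \<xi> \<partial>lborel)
      = complex_of_real (?S * (\<integral>u. f (x + u) * (real (Suc n) ^ ?D * gauss (real (Suc n) *\<^sub>R u)) \<partial>lborel))" for n
    by (rule gaussian_regularized_inversion[OF f F]) simp
  have lim': "(\<lambda>n. complex_of_real (?S * (\<integral>u. f (x + u) * (real (Suc n) ^ ?D * gauss (real (Suc n) *\<^sub>R u)) \<partial>lborel)))
      \<longlonglongrightarrow> complex_of_real (?S * f x)"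
    by (intro tendsto_of_real tendsto_mult tendsto_const approximate_identity[OF f cont])
  have "(\<integral>\<xi>. complex_of_real (gauss (0 :: real ^ 'd)) * ?e \<xi> \<partial>lborel) = complex_of_real (?S * f x)"
    by (rule LIMSEQ_unique[OF lim[unfolded eq] lim'])
  then have "integral\<^sup>L lborel ?e / complex_of_real ?S = complex_of_real (?S * f x)"
    by (simp add: gauss_eq)
  moreover have "?S \<noteq> 0" by simp
  ultimately have "integral\<^sup>L lborel ?e = complex_of_real (?S * f x) * complex_of_real ?S"
    by (simp add: divide_eq_eq)
  also have "\<dots> = complex_of_real (?S * ?S * f x)"
    by simp
  also have "?S * ?S = (sqrt (2 * pi) * sqrt (2 * pi)) ^ ?D"
    by (rule power_mult_distrib[symmetric])
  also have "sqrt (2 * pi) * sqrt (2 * pi) = 2 * pi"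
    by simp
  finally show ?thesis .
qed

section \<open>Approximation of a mean by sampling\<close>

lemma (in prob_space) exists_le_expectation:
  fixes X :: "'a \<Rightarrow> real"
  assumes "integrable M X" "expectation X \<le> b"
  shows "\<exists>w\<in>space M. X w \<le> b"
proof (rule ccontr)
  assume "\<not> ?thesis"
  then have "AE w in M. b < X w" by (intro AE_I2) auto
  then have "b < expectation X" by (rule expectation_greater[OF assms(1)])
  with assms(2) show False by simp
qed

text \<open>If w is drawn at random, the error \<open>F x - h x w\<close> has mean 0 for every x, so on average it is orthogonal
  to g in the mean square sense, and adds at most the second moment of h. Some w does at least as well as
  the average.\<close>

lemma (in pair_prob_space) sampling_step:
  fixes h :: "'a \<Rightarrow> 'b \<Rightarrow> real" and g :: "'a \<Rightarrow> real"
  assumes h [measurable]: "case_prod h \<in> borel_measurable (M1 \<Otimes>\<^sub>M M2)"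
    and C: "\<And>x w. \<bar>h x w\<bar> \<le> C"
    and g [measurable]: "g \<in> borel_measurable M1" and B: "\<And>x. \<bar>g x\<bar> \<le> B"
  shows "\<exists>w\<in>space M2. (\<integral>x. (g x + ((\<integral>v. h x v \<partial>M2) - h x w))\<^sup>2 \<partial>M1) \<le> (\<integral>x. (g x)\<^sup>2 \<partial>M1) + C\<^sup>2"
proof -
  define F where "F x = (\<integral>v. h x v \<partial>M2)" for x
  have F_meas [measurable]: "F \<in> borel_measurable M1"
    unfolding F_def[abs_def] by measurable
  have C0: "0 \<le> C" using C[of undefined undefined] by linarith
  have h_int: "integrable M2 (h x)" "integrable M2 (\<lambda>w. (h x w)\<^sup>2)" if [measurable]: "x \<in> space M1" for x
  proof -
    have [measurable]: "h x \<in> borel_measurable M2"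
      using measurable_compose[OF measurable_Pair1'[OF that] h] by simp
    show "integrable M2 (h x)"
      by (rule M2.integrable_const_bound[where B = C]) (use C in auto)
    show "integrable M2 (\<lambda>w. (h x w)\<^sup>2)"
      by (rule M2.integrable_const_bound[where B = "C\<^sup>2"]) (use C in \<open>auto intro!: abs_le_square_iff[THEN iffD1] simp: C0\<close>)
  qed
  have F_bound: "\<bar>F x\<bar> \<le> C" if "x \<in> space M1" for x
  proof -
    have "\<bar>F x\<bar> \<le> (\<integral>v. \<bar>h x v\<bar> \<partial>M2)" unfolding F_def by (rule integral_abs_bound)
    also have "\<dots> \<le> C"
      by (rule M2.integral_le_const) (use h_int(1)[OF that] C in auto)
    finally show ?thesis .
  qed
  define K where "K x w = (g x + (F x - h x w))\<^sup>2" for x w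
  have K_int: "integrable (M1 \<Otimes>\<^sub>M M2) (case_prod K)"
  proof (rule P.integrable_const_bound[where B = "(B + 2 * C)\<^sup>2"])
    show "AE z in M1 \<Otimes>\<^sub>M M2. norm (case_prod K z) \<le> (B + 2 * C)\<^sup>2"
    proof (rule AE_I2)
      fix z assume "z \<in> space (M1 \<Otimes>\<^sub>M M2)"
      then obtain x w where z: "z = (x, w)" "x \<in> space M1" by (auto simp: space_pair_measure)
      have "\<bar>g x + (F x - h x w)\<bar> \<le> B + 2 * C"
        using B[of x] F_bound[OF z(2)] C[of x w] by linarith
      then have "(g x + (F x - h x w))\<^sup>2 \<le> (B + 2 * C)\<^sup>2"
        by (metis abs_ge_zero power2_abs power_mono)
      then show "norm (case_prod K z) \<le> (B + 2 * C)\<^sup>2" by (simp add: z K_def)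
    qed
    show "case_prod K \<in> borel_measurable (M1 \<Otimes>\<^sub>M M2)"
      unfolding K_def[abs_def] split_beta' using h by (auto simp: split_beta')
  qed
  have g2: "integrable M1 (\<lambda>x. (g x)\<^sup>2)"
  proof (rule M1.integrable_const_bound[where B = "B\<^sup>2"])
    have "(g x)\<^sup>2 \<le> B\<^sup>2" for x
      using B[of x] by (metis abs_ge_zero power2_abs power_mono)
    then show "AE x in M1. norm ((g x)\<^sup>2) \<le> B\<^sup>2" by simp
  qed measurable
  have inner: "(\<integral>w. K x w \<partial>M2) \<le> (g x)\<^sup>2 + C\<^sup>2" if x: "x \<in> space M1" for x
  proof -
    note i = h_int[OF x]
    have K: "K x = (\<lambda>w. (g x + F x)\<^sup>2 - 2 * (g x + F x) * h x w + (h x w)\<^sup>2)"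
      by (simp add: K_def fun_eq_iff power2_eq_square algebra_simps)
    have "(\<integral>w. K x w \<partial>M2) = (g x + F x)\<^sup>2 - 2 * (g x + F x) * F x + (\<integral>w. (h x w)\<^sup>2 \<partial>M2)"
      unfolding K using i by (simp add: F_def M2.prob_space)
    also have "(\<integral>w. (h x w)\<^sup>2 \<partial>M2) \<le> C\<^sup>2"
      by (rule M2.integral_le_const[OF i(2)]) (use C in \<open>auto intro!: AE_I2 abs_le_square_iff[THEN iffD1] simp: C0\<close>)
    also have "(g x + F x)\<^sup>2 - 2 * (g x + F x) * F x + C\<^sup>2 = (g x)\<^sup>2 - (F x)\<^sup>2 + C\<^sup>2"
      by (simp add: power2_eq_square algebra_simps)
    also have "\<dots> \<le> (g x)\<^sup>2 + C\<^sup>2" by simp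
    finally show ?thesis by simp
  qed
  have "(\<integral>w. (\<integral>x. K x w \<partial>M1) \<partial>M2) = (\<integral>x. (\<integral>w. K x w \<partial>M2) \<partial>M1)"
    by (rule Fubini_integral[OF K_int])
  also have "\<dots> \<le> (\<integral>x. (g x)\<^sup>2 + C\<^sup>2 \<partial>M1)"
    by (intro integral_mono integrable_fst[OF K_int] Bochner_Integration.integrable_add g2 inner) auto
  also have "\<dots> = (\<integral>x. (g x)\<^sup>2 \<partial>M1) + C\<^sup>2"
    using g2 by (simp add: M1.prob_space)
  finally have "M2.expectation (\<lambda>w. \<integral>x. K x w \<partial>M1) \<le> (\<integral>x. (g x)\<^sup>2 \<partial>M1) + C\<^sup>2" .
  then show ?thesis
    using M2.exists_le_expectation[OF integrable_snd[OF K_int]] by (simp add: K_def F_def)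
qed


text \<open>Maurey's empirical method. Choosing the sample points one after the other, each no worse than average,
  keeps the squared error of the sum linear in the number of points, and avoids joint distributions.\<close>

lemma (in pair_prob_space) maurey_sampling:
  fixes h :: "'a \<Rightarrow> 'b \<Rightarrow> real"
  assumes h [measurable]: "case_prod h \<in> borel_measurable (M1 \<Otimes>\<^sub>M M2)"
    and C: "\<And>x w. \<bar>h x w\<bar> \<le> C" and F: "\<And>x. F x = (\<integral>v. h x v \<partial>M2)"
    and F_bound: "\<And>x. \<bar>F x\<bar> \<le> C"
  shows "\<exists>w. (\<forall>p. w p \<in> space M2) \<and> (\<integral>x. (\<Sum>p = 1..m. F x - h x (w p))\<^sup>2 \<partial>M1) \<le> real m * C\<^sup>2"
proof (induction m)
  case 0
  obtain v where "v \<in> space M2" using M2.not_empty by blast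
  then show ?case by (intro exI[of _ "\<lambda>_. v"]) simp
next
  case (Suc m)
  then obtain w where w: "\<And>p. w p \<in> space M2"
    and le: "(\<integral>x. (\<Sum>p = 1..m. F x - h x (w p))\<^sup>2 \<partial>M1) \<le> real m * C\<^sup>2" by blast
  let ?g = "\<lambda>x. \<Sum>p = 1..m. F x - h x (w p)"
  have [measurable]: "F \<in> borel_measurable M1"
    unfolding F[abs_def] by measurable
  have [measurable]: "(\<lambda>x. h x (w p)) \<in> borel_measurable M1" for p
    using measurable_compose[OF measurable_Pair2'[OF w] h] by simp
  have "\<bar>?g x\<bar> \<le> real m * (2 * C)" for x
  proof -
    have "\<bar>?g x\<bar> \<le> (\<Sum>p = 1..m. \<bar>F x - h x (w p)\<bar>)" by (rule sum_abs)
    also have "\<dots> \<le> (\<Sum>p = 1..m. 2 * C)"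
    proof (rule sum_mono)
      fix p show "\<bar>F x - h x (w p)\<bar> \<le> 2 * C"
        using C[of x "w p"] F_bound[of x] by linarith
    qed
    finally show ?thesis by simp
  qed
  then obtain v where v: "v \<in> space M2"
    and v_le: "(\<integral>x. (?g x + (F x - h x v))\<^sup>2 \<partial>M1) \<le> (\<integral>x. (?g x)\<^sup>2 \<partial>M1) + C\<^sup>2"
    using sampling_step[OF h C, of ?g "real m * (2 * C)"] by (auto simp: F)
  let ?w = "w(Suc m := v)"
  have eq: "(\<Sum>p = 1..Suc m. F x - h x (?w p)) = ?g x + (F x - h x v)" for x
  proof -
    have "(\<Sum>p = 1..m. F x - h x (?w p)) = ?g x"
      by (rule sum.cong) auto
    then show ?thesis by simp
  qed
  have "real (Suc m) * C\<^sup>2 = real m * C\<^sup>2 + C\<^sup>2"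
    by (simp add: algebra_simps)
  then have "(\<integral>x. (\<Sum>p = 1..Suc m. F x - h x (?w p))\<^sup>2 \<partial>M1) \<le> real (Suc m) * C\<^sup>2"
    unfolding eq using v_le le by linarith
  moreover have "\<forall>p. ?w p \<in> space M2" using w v by simp
  ultimately show ?case by blast
qed

section \<open>Approximation by quantum neural networks\<close>

lemma fourier_inversion_bound:
  fixes f :: "real ^ 'd \<Rightarrow> real"
  assumes "integrable lborel f" "integrable lborel (fourier f)" "isCont f x"
  shows "\<bar>f x\<bar> \<le> l1_norm (fourier f) / (2 * pi) ^ DIM(real ^ 'd)"
proof -
  have "(2 * pi) ^ DIM(real ^ 'd) * \<bar>f x\<bar> = norm (complex_of_real ((2 * pi) ^ DIM(real ^ 'd) * f x))"
    unfolding norm_of_real by (simp add: abs_mult)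
  also have "\<dots> = norm (\<integral>\<xi>. fourier f \<xi> * exp (\<i> * complex_of_real (inner \<xi> x)) \<partial>lborel)"
    unfolding fourier_inversion[OF assms] ..
  also have "\<dots> \<le> (\<integral>\<xi>. norm (fourier f \<xi> * exp (\<i> * complex_of_real (inner \<xi> x))) \<partial>lborel)"
    by (rule integral_norm_bound)
  also have "\<dots> = l1_norm (fourier f)"
    by (simp add: l1_norm_def norm_mult)
  finally show ?thesis by (simp add: pos_le_divide_eq mult.commute)
qed

text \<open>By the inversion formula f is the mean of the functions
  \<open>x \<mapsto> C * cos (inner \<xi> x + Arg (fourier f \<xi>))\<close>, where \<open>\<xi>\<close> is distributed with density proportional
  to the modulus of the Fourier transform. Maurey's method picks m frequencies from this distribution.\<close>

lemma cosine_approximation: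
  fixes f :: "real ^ 'd \<Rightarrow> real" and \<mu> :: "(real ^ 'd) measure"
  assumes \<mu>: "prob_space \<mu>" "sets \<mu> = sets borel"
    and f: "continuous_on UNIV f" "integrable lborel f" "integrable lborel (fourier f)"
    and C: "C = l1_norm (fourier f) / (2 * pi) ^ DIM(real ^ 'd)" "C > 0"
    and m: "m \<ge> 1"
  shows "\<exists>c w \<beta>. (\<integral>x. (f x - (\<Sum>p = 1..m. c p * cos (inner (w p) x + \<beta> p)))\<^sup>2 \<partial>\<mu>) \<le> C\<^sup>2 / real m"
proof -
  let ?D = "DIM(real ^ 'd)" and ?F = "fourier f" and ?A = "l1_norm (fourier f)"
  have [measurable]: "?F \<in> borel_measurable borel" using f(3) by auto
  have "?A \<noteq> 0" using C by auto
  moreover have "?A \<ge> 0" by (simp add: l1_norm_def)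
  ultimately have A: "?A > 0" by simp
  define \<rho> where "\<rho> = density lborel (\<lambda>\<xi>. ennreal (norm (?F \<xi>) / ?A))"
  have "prob_space \<rho>"
  proof (rule prob_spaceI)
    have "emeasure \<rho> (space \<rho>) = (\<integral>\<^sup>+ \<xi>. ennreal (norm (?F \<xi>) / ?A) \<partial>lborel)"
      by (simp add: \<rho>_def emeasure_density)
    also have "\<dots> = ennreal (\<integral>\<xi>. norm (?F \<xi>) / ?A \<partial>lborel)"
      using f(3) A by (intro nn_integral_eq_integral) auto
    also have "(\<integral>\<xi>. norm (?F \<xi>) / ?A \<partial>lborel) = 1"
      using A by (simp add: l1_norm_def)
    finally show "emeasure \<rho> (space \<rho>) = 1" by simp
  qed
  then interpret M2: prob_space \<rho> .
  interpret M1: prob_space \<mu> by fact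
  interpret pair_prob_space \<mu> \<rho> ..
  define h where "h x \<xi> = C * Re (?F \<xi> / complex_of_real (norm (?F \<xi>)) * exp (\<i> * complex_of_real (inner \<xi> x)))" for x \<xi>
  have h_bound: "\<bar>h x \<xi>\<bar> \<le> C" for x \<xi>
  proof -
    have "\<bar>Re (?F \<xi> / complex_of_real (norm (?F \<xi>)) * exp (\<i> * complex_of_real (inner \<xi> x)))\<bar>
        \<le> norm (?F \<xi> / complex_of_real (norm (?F \<xi>)) * exp (\<i> * complex_of_real (inner \<xi> x)))"
      by (rule abs_Re_le_cmod)
    also have "\<dots> \<le> 1" by (simp add: norm_mult norm_divide)
    finally have "C * \<bar>Re (?F \<xi> / complex_of_real (norm (?F \<xi>)) * exp (\<i> * complex_of_real (inner \<xi> x)))\<bar> \<le> C * 1"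
      using C(2) by (intro mult_left_mono) auto
    then show ?thesis unfolding h_def abs_mult using C(2) by (simp only: abs_of_pos mult_1_right)
  qed
  have sets_eq: "sets (\<mu> \<Otimes>\<^sub>M \<rho>) = sets (borel \<Otimes>\<^sub>M borel)"
    by (rule sets_pair_measure_cong) (simp_all add: \<mu>(2) \<rho>_def)
  have h_meas: "case_prod h \<in> borel_measurable (\<mu> \<Otimes>\<^sub>M \<rho>)"
    unfolding measurable_cong_sets[OF sets_eq refl] h_def[abs_def] by measurable
  have h_mean: "f x = (\<integral>\<xi>. h x \<xi> \<partial>\<rho>)" for x
  proof -
    let ?e = "\<lambda>\<xi>. ?F \<xi> * exp (\<i> * complex_of_real (inner \<xi> x))"
    have "isCont f x" using f(1) by (simp add: continuous_on_eq_continuous_at)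
    note inv = fourier_inversion[OF f(2,3) this]
    have e_int: "integrable lborel ?e"
      by (rule Bochner_Integration.integrable_bound[OF f(3)]) (auto simp: norm_mult)
    have "(\<integral>\<xi>. h x \<xi> \<partial>\<rho>) = (\<integral>\<xi>. (norm (?F \<xi>) / ?A) *\<^sub>R h x \<xi> \<partial>lborel)"
      unfolding \<rho>_def using A by (intro integral_density) (auto simp: h_def)
    also have "\<dots> = (\<integral>\<xi>. C / ?A * Re (?e \<xi>) \<partial>lborel)"
    proof (rule Bochner_Integration.integral_cong[OF refl])
      fix \<xi>
      have "norm (?F \<xi>) * Re (?F \<xi> / complex_of_real (norm (?F \<xi>)) * exp (\<i> * complex_of_real (inner \<xi> x)))
          = Re (complex_of_real (norm (?F \<xi>)) * (?F \<xi> / complex_of_real (norm (?F \<xi>)) * exp (\<i> * complex_of_real (inner \<xi> x))))"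
        by (simp only: Re_complex_of_real Im_complex_of_real times_complex.simps)
      also have "complex_of_real (norm (?F \<xi>)) * (?F \<xi> / complex_of_real (norm (?F \<xi>)) * exp (\<i> * complex_of_real (inner \<xi> x))) = ?e \<xi>"
        by simp
      finally show "(norm (?F \<xi>) / ?A) *\<^sub>R h x \<xi> = C / ?A * Re (?e \<xi>)"
        by (simp add: h_def)
    qed
    also have "\<dots> = C / ?A * Re (integral\<^sup>L lborel ?e)"
      by (simp only: integral_mult_right_zero integral_Re[OF e_int])
    also have "\<dots> = f x"
      unfolding inv C(1) using A by simp
    finally show ?thesis by simp
  qed
  have f_bound: "\<bar>f x\<bar> \<le> C" for x
    unfolding C(1) by (rule fourier_inversion_bound[OF f(2,3)]) (use f(1) in \<open>simp add: continuous_on_eq_continuous_at\<close>)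
  obtain w where w: "(\<integral>x. (\<Sum>p = 1..m. f x - h x (w p))\<^sup>2 \<partial>\<mu>) \<le> real m * C\<^sup>2"
    using maurey_sampling[of h C f m, OF h_meas h_bound h_mean f_bound] by blast
  \<comment> \<open>Frequencies at which the transform vanishes carry no mass but are not excluded; there h is 0 and
    has no phase, so the coefficient is set to 0.\<close>
  define c where "c p = (if ?F (w p) = 0 then 0 else C / real m)" for p
  have h_cos: "h x (w p) = real m * (c p * cos (inner (w p) x + Arg (?F (w p))))" for x p
  proof (cases "?F (w p) = 0")
    case False
    have "?F (w p) / complex_of_real (norm (?F (w p))) = cis (Arg (?F (w p)))"
      using False by (simp add: cis_Arg sgn_div_norm scaleR_conv_of_real divide_inverse mult.commute)
    then have "h x (w p) = C * Re (cis (Arg (?F (w p)) + inner (w p) x))"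
      by (simp add: h_def flip: cis_mult cis_conv_exp)
    then show ?thesis using False m by (simp add: c_def add.commute)
  qed (simp add: h_def c_def)
  have "(f x - (\<Sum>p = 1..m. c p * cos (inner (w p) x + Arg (?F (w p)))))\<^sup>2
      = (\<Sum>p = 1..m. f x - h x (w p))\<^sup>2 / (real m)\<^sup>2" for x
  proof -
    have "(\<Sum>p = 1..m. f x - h x (w p)) = real m * (f x - (\<Sum>p = 1..m. c p * cos (inner (w p) x + Arg (?F (w p)))))"
      unfolding h_cos by (simp add: sum_subtractf right_diff_distrib sum_distrib_left)
    then show ?thesis using m by (simp add: power_mult_distrib)
  qed
  then have "(\<integral>x. (f x - (\<Sum>p = 1..m. c p * cos (inner (w p) x + Arg (?F (w p)))))\<^sup>2 \<partial>\<mu>)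
      = (\<integral>x. (\<Sum>p = 1..m. f x - h x (w p))\<^sup>2 \<partial>\<mu>) / (real m)\<^sup>2"
    by simp
  also have "\<dots> \<le> real m * C\<^sup>2 / (real m)\<^sup>2"
    using w by (intro divide_right_mono) auto
  also have "\<dots> = C\<^sup>2 / real m"
    using m by (simp add: power2_eq_square)
  finally show ?thesis
    by (intro exI[of _ c] exI[of _ w] exI[of _ "\<lambda>p. Arg (?F (w p))"])
qed

text \<open>The square of this factor, at least 36, is what is gained over the bound of the theorem because the
  inversion formula carries \<open>(2 * pi) ^ d\<close>. It pays for using fewer cosines than qubits.\<close>

lemma two_pi_power_ge_6: "(2 * pi) ^ DIM(real ^ 'd) \<ge> 6"
proof -
  have "(6 :: real) \<le> 2 * pi" using pi_gt3 by simp
  also have "(2 * pi) ^ 1 \<le> (2 * pi) ^ DIM(real ^ 'd)"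
    using pi_gt3 by (intro power_increasing) (auto simp: Suc_leI)
  finally show ?thesis by simp
qed

theorem theorem4p1:
  fixes \<mu> :: "(real ^ 'd) measure"
    and f :: "real ^ 'd \<Rightarrow> real"
    and L n :: nat
  assumes "prob_space \<mu>" and "sets \<mu> = sets borel"
    and "continuous_on UNIV f" and "integrable lborel f"
    and "integrable lborel (fourier f)"
    and "L \<ge> 1" and "n \<ge> 1"
  shows "\<exists>(a :: nat \<Rightarrow> real ^ 'd) (b :: nat \<Rightarrow> real) (\<Gamma> :: nat \<Rightarrow> nat \<Rightarrow> real \<times> real \<times> real)
           (c :: nat \<Rightarrow> real) (c0 :: real).
           integrable \<mu> (\<lambda>x. (norm (complex_of_real (f x) - qnn_output n L a b \<Gamma> c c0 x))\<^sup>2) \<and>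
           l2_norm \<mu> (\<lambda>x. complex_of_real (f x) - qnn_output n L a b \<Gamma> c c0 x)
             \<le> l1_norm (fourier f) / sqrt (real n)"
proof -
  interpret prob_space \<mu> by fact
  let ?A = "l1_norm (fourier f)"
  define C where "C = ?A / (2 * pi) ^ DIM(real ^ 'd)"
  have A0: "0 \<le> ?A" by (simp add: l1_norm_def)
  have C0: "0 \<le> C" unfolding C_def using A0 by simp
  have "C \<le> ?A / 6"
    unfolding C_def using A0 two_pi_power_ge_6[where 'd = 'd] by (intro divide_left_mono) auto
  then have CA: "C\<^sup>2 \<le> ?A\<^sup>2 / 36"
    using power_mono[OF _ C0, of "?A / 6" 2] by (simp add: power_divide)
  have f_bound: "\<bar>f x\<bar> \<le> C" for x
    unfolding C_def using assms by (intro fourier_inversion_bound) (auto simp: continuous_on_eq_continuous_at)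
  \<comment> \<open>The number of disjoint pairs (2 p, 2 p + 1) among the qubits 2, ..., n.\<close>
  define m where "m = (n - 1) div 2"
  \<comment> \<open>Without pairs, that is for \<open>n \<le> 2\<close>, the zero network is good enough by \<open>C \<le> ?A / 6\<close>; if C = 0, then f
    vanishes and there is no distribution to sample from.\<close>
  have "\<exists>c w \<beta>. (\<integral>x. (f x - (\<Sum>p = 1..m. c p * cos (inner (w p) x + \<beta> p)))\<^sup>2 \<partial>\<mu>) \<le> ?A\<^sup>2 / real n"
  proof (cases "C = 0 \<or> m = 0")
    case True
    have f_meas: "f \<in> borel_measurable \<mu>"
      using borel_measurable_continuous_onI[OF assms(3)] assms(2) by (simp cong: measurable_cong_sets)
    have f2: "(f x)\<^sup>2 \<le> C\<^sup>2" for x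
      using f_bound[of x] by (metis abs_ge_zero power2_abs power_mono)
    have "(\<integral>x. (f x)\<^sup>2 \<partial>\<mu>) \<le> C\<^sup>2"
      by (rule integral_le_const)
        (use f2 f_meas in \<open>auto intro!: integrable_const_bound[where B = "C\<^sup>2"]\<close>)
    also have "C\<^sup>2 \<le> ?A\<^sup>2 / real n"
    proof (cases "C = 0")
      case False
      then have "n \<le> 2" using True by (auto simp: m_def)
      then have "?A\<^sup>2 / 36 \<le> ?A\<^sup>2 / real n" using assms(7) by (intro divide_left_mono) auto
      with CA show ?thesis by linarith
    qed simp
    finally show ?thesis by (intro exI[of _ "\<lambda>_. 0"]) simp
  next
    case False
    then have m: "m \<ge> 1" and C: "C > 0" using C0 by auto
    obtain c w \<beta> where "(\<integral>x. (f x - (\<Sum>p = 1..m. c p * cos (inner (w p) x + \<beta> p)))\<^sup>2 \<partial>\<mu>) \<le> C\<^sup>2 / real m"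
      using cosine_approximation[OF assms(1-5) C_def C m] by blast
    moreover have "C\<^sup>2 / real m \<le> ?A\<^sup>2 / real n"
    proof -
      have "n \<le> 36 * m" using m by (auto simp: m_def)
      then have "?A\<^sup>2 / (36 * real m) \<le> ?A\<^sup>2 / real n"
        using assms(7) by (intro divide_left_mono) (auto simp flip: of_nat_mult)
      moreover have "C\<^sup>2 / real m \<le> ?A\<^sup>2 / 36 / real m"
        using CA by (intro divide_right_mono) auto
      ultimately show ?thesis by simp
    qed
    ultimately show ?thesis by (meson order_trans)
  qed
  then obtain c w \<beta> where le: "(\<integral>x. (f x - (\<Sum>p = 1..m. c p * cos (inner (w p) x + \<beta> p)))\<^sup>2 \<partial>\<mu>) \<le> ?A\<^sup>2 / real n"
    by blast
  define u where "u x = (\<Sum>p = 1..m. c p * cos (inner (w p) x + \<beta> p))" for x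
  have "2 * m < n" using assms(7) by (auto simp: m_def)
  from qnn_realizes_cosine_sum[OF assms(6) this, of c w \<beta>]
  obtain a b \<Gamma> c' where qnn: "\<And>x. qnn_output n L a b \<Gamma> c' 0 x = complex_of_real (u x)"
    unfolding u_def by blast
  have norm_eq: "(norm (complex_of_real (f x) - qnn_output n L a b \<Gamma> c' 0 x))\<^sup>2 = (f x - u x)\<^sup>2" for x
    unfolding qnn by (simp flip: of_real_diff)
  have "integrable \<mu> (\<lambda>x. (f x - u x)\<^sup>2)"
  proof (rule integrable_const_bound[where B = "(C + (\<Sum>p = 1..m. \<bar>c p\<bar>))\<^sup>2"])
    have u_bound: "\<bar>u x\<bar> \<le> (\<Sum>p = 1..m. \<bar>c p\<bar>)" for x
      unfolding u_def by (rule order_trans[OF sum_abs sum_mono]) (simp add: abs_mult mult_left_le)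
    then have "\<bar>f x - u x\<bar> \<le> C + (\<Sum>p = 1..m. \<bar>c p\<bar>)" for x
      using f_bound[of x] u_bound[of x] by linarith
    then show "AE x in \<mu>. norm ((f x - u x)\<^sup>2) \<le> (C + (\<Sum>p = 1..m. \<bar>c p\<bar>))\<^sup>2"
      by (intro AE_I2) (metis abs_ge_zero norm_power power2_abs power_mono real_norm_def)
    have [measurable]: "f \<in> borel_measurable borel"
      by (rule borel_measurable_continuous_onI[OF assms(3)])
    have "(\<lambda>x. (f x - u x)\<^sup>2) \<in> borel_measurable borel"
      unfolding u_def by measurable
    then show "(\<lambda>x. (f x - u x)\<^sup>2) \<in> borel_measurable \<mu>"
      using assms(2) by (simp cong: measurable_cong_sets)
  qed
  moreover have "sqrt (\<integral>x. (f x - u x)\<^sup>2 \<partial>\<mu>) \<le> ?A / sqrt (real n)"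
  proof -
    have "sqrt (\<integral>x. (f x - u x)\<^sup>2 \<partial>\<mu>) \<le> sqrt (?A\<^sup>2 / real n)"
      using le by (simp add: u_def)
    then show ?thesis using A0 by (simp add: real_sqrt_divide)
  qed
  ultimately show ?thesis
    unfolding l2_norm_def by (intro exI[of _ a] exI[of _ b] exI[of _ \<Gamma>] exI[of _ c'] exI[of _ 0]) (simp only: norm_eq)
qed

end
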